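(* Let $u\in H^1(\Omega)$, $\Omega=\Omega_1\times\Omega_2$, let $\{\sigma_k\}_{k\in\mathbb N}$, $\{\psi_k\}_{k\in\mathbb N}$, $\{\phi_k\}_{k\in\mathbb N}$ be the singular values and the left and right singular functions of an $L^2$-singular value decomposition of $u$, and for $r\in\mathbb N$ let $$u_r:=\sum_{k=1}^r\sigma_k\,\psi_k\otimes\phi_k$$ be the corresponding best rank-$r$ approximation of $u$ in $L^2(\Omega)$. Then for every $r\in\mathbb N$ $$\|u_r\|_1^2=\sum_{k=1}^r\sigma_k^2\left(1+\left\|\frac{d}{dx}\psi_k\right\|_0^2+\left\|\frac{d}{dy}\phi_k\right\|_0^2\right).$$ If moreover $$\lim_{r\to\infty}\|u_r\|_1<\infty,$$ then $\|u-u_r\|_1\to 0$ as $r\to\infty$ and, for every $r\in\mathbb N$, $$\|u-u_r\|_1^2=\sum_{k=r+1}^\infty\sigma_k^2\left(1+\left\|\frac{d}{dx}\psi_k\right\|_0^2+\left\|\frac{d}{dy}\phi_k\right\|_0^2\right).$$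
   Context: $\Omega_1,\Omega_2\subset\mathbb R$ are domains (open intervals), with variables $x\in\Omega_1$, $y\in\Omega_2$. $\|\cdot\|_0$ denotes the $L^2$-norm and $\|\cdot\|_1$ the $H^1$-norm, both on $\Omega$ and on each $\Omega_j$; on $\Omega$, $\|v\|_1^2=\|v\|_0^2+\|\partial_x v\|_0^2+\|\partial_y v\|_0^2$. The elementary tensor is $(\psi\otimes\phi)(x,y)=\psi(x)\phi(y)$. $L^2$-SVD: a function $u\in L^2(\Omega_1\times\Omega_2)$ is identified with the compact (Hilbert–Schmidt) operator $L^2(\Omega_2)\to L^2(\Omega_1)$, $w\mapsto\int_{\Omega_2}u(\cdot,y)w(y)\,dy$. Its SVD consists of a non-increasing sequence of singular values $\sigma_k\ge 0$ and of $L^2$-orthonormal systems $\{\psi_k\}\subset L^2(\Omega_1)$ (left singular functions) and $\{\phi_k\}\subset L^2(\Omega_2)$ (right singular functions) such that $u=\sum_{k}\sigma_k\psi_k\otimes\phi_k$ in $L^2(\Omega)$. If $u\in H^1(\Omega)$, then for all $k$ with $\sigma_k>0$ one has $\psi_k\in H^1(\Omega_1)$ and $\phi_k\in H^1(\Omega_2)$, and $\frac{d}{dx}\psi_k$, $\frac{d}{dy}\phi_k$ denote weak derivatives. If only finitely many $\sigma_k$ are positive, only the corresponding singular functions are used: terms with $\sigma_k=0$ are omitted (equal to zero) in all sums. *)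

theory Defs
  imports "HOL-Analysis.Analysis"
begin

text \<open>
  Functions are real-valued. Elements of Lebesgue spaces are represented by functions, of which
  only the values on \<open>\<Omega>\<close> matter, up to null sets. Representatives are Borel measurable; as every
  Lebesgue measurable function agrees almost everywhere with a Borel measurable one, this gives
  the usual space of equivalence classes. On \<open>real \<times> real\<close>, \<open>lborel\<close> is the planar Lebesgue
  measure.
\<close>

abbreviation lborel_on :: "'a::euclidean_space set \<Rightarrow> 'a measure" where
  "lborel_on \<Omega> \<equiv> restrict_space lborel \<Omega>"

definition L2 :: "'a::euclidean_space set \<Rightarrow> ('a \<Rightarrow> real) set" where
  "L2 \<Omega> = {f \<in> borel_measurable (lborel_on \<Omega>). integrable (lborel_on \<Omega>) (\<lambda>x. (f x)\<^sup>2)}"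

definition L2_inner :: "'a::euclidean_space set \<Rightarrow> ('a \<Rightarrow> real) \<Rightarrow> ('a \<Rightarrow> real) \<Rightarrow> real" where
  "L2_inner \<Omega> f g = (LINT x|lborel_on \<Omega>. f x * g x)"

definition L2_norm :: "'a::euclidean_space set \<Rightarrow> ('a \<Rightarrow> real) \<Rightarrow> real" where
  "L2_norm \<Omega> f = sqrt (LINT x|lborel_on \<Omega>. (f x)\<^sup>2)"

definition L2_orthonormal ::
    "'a::euclidean_space set \<Rightarrow> 'i set \<Rightarrow> ('i \<Rightarrow> 'a \<Rightarrow> real) \<Rightarrow> bool" where
  "L2_orthonormal \<Omega> I f \<longleftrightarrow>
     (\<forall>k\<in>I. f k \<in> L2 \<Omega>) \<and>
     (\<forall>j\<in>I. \<forall>k\<in>I. L2_inner \<Omega> (f j) (f k) = (if j = k then 1 else 0))"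

definition partial_deriv :: "'a::euclidean_space \<Rightarrow> ('a \<Rightarrow> real) \<Rightarrow> 'a \<Rightarrow> real" where
  "partial_deriv b f x = frechet_derivative f (at x) b"

primrec Ck :: "nat \<Rightarrow> ('a::euclidean_space \<Rightarrow> real) \<Rightarrow> bool" where
  "Ck 0 f \<longleftrightarrow> continuous_on UNIV f"
| "Ck (Suc n) f \<longleftrightarrow> f differentiable_on UNIV \<and> (\<forall>b\<in>Basis. Ck n (partial_deriv b f))"

definition test_function :: "'a::euclidean_space set \<Rightarrow> ('a \<Rightarrow> real) \<Rightarrow> bool" where
  "test_function \<Omega> \<eta> \<longleftrightarrow>
     (\<forall>n. Ck n \<eta>) \<and> compact (closure {x. \<eta> x \<noteq> 0}) \<and> closure {x. \<eta> x \<noteq> 0} \<subseteq> \<Omega>"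

definition has_weak_partial ::
    "'a::euclidean_space set \<Rightarrow> 'a \<Rightarrow> ('a \<Rightarrow> real) \<Rightarrow> ('a \<Rightarrow> real) \<Rightarrow> bool" where
  "has_weak_partial \<Omega> b f g \<longleftrightarrow> f \<in> L2 \<Omega> \<and> g \<in> L2 \<Omega> \<and>
     (\<forall>\<eta>. test_function \<Omega> \<eta> \<longrightarrow>
        (LINT x|lborel_on \<Omega>. f x * partial_deriv b \<eta> x) = - (LINT x|lborel_on \<Omega>. g x * \<eta> x))"

text \<open>
  For open \<open>\<Omega>\<close> weak derivatives are unique up to null sets, so the norms below do not depend on
  the chosen representative. The value is arbitrary if there is no weak derivative in \<open>L2 \<Omega>\<close>.
\<close>

definition weak_partial :: "'a::euclidean_space set \<Rightarrow> 'a \<Rightarrow> ('a \<Rightarrow> real) \<Rightarrow> 'a \<Rightarrow> real" where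
  "weak_partial \<Omega> b f = (SOME g. has_weak_partial \<Omega> b f g)"

abbreviation weak_deriv :: "real set \<Rightarrow> (real \<Rightarrow> real) \<Rightarrow> real \<Rightarrow> real" where
  "weak_deriv \<Omega> f \<equiv> weak_partial \<Omega> 1 f"

definition H1 :: "'a::euclidean_space set \<Rightarrow> ('a \<Rightarrow> real) set" where
  "H1 \<Omega> = {f \<in> L2 \<Omega>. \<forall>b\<in>Basis. \<exists>g. has_weak_partial \<Omega> b f g}"

text \<open>On \<open>real \<times> real\<close> the basis is \<open>{(1, 0), (0, 1)}\<close>, on \<open>real\<close> it is \<open>{1}\<close>.\<close>

definition H1_norm :: "'a::euclidean_space set \<Rightarrow> ('a \<Rightarrow> real) \<Rightarrow> real" where
  "H1_norm \<Omega> f = sqrt ((L2_norm \<Omega> f)\<^sup>2 + (\<Sum>b\<in>Basis. (L2_norm \<Omega> (weak_partial \<Omega> b f))\<^sup>2))"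

definition tensor :: "(real \<Rightarrow> real) \<Rightarrow> (real \<Rightarrow> real) \<Rightarrow> real \<times> real \<Rightarrow> real" where
  "tensor f g = (\<lambda>(x, y). f x * g y)"

definition svd_partial_sum ::
    "(nat \<Rightarrow> real) \<Rightarrow> (nat \<Rightarrow> real \<Rightarrow> real) \<Rightarrow> (nat \<Rightarrow> real \<Rightarrow> real) \<Rightarrow> nat \<Rightarrow> real \<times> real \<Rightarrow> real" where
  "svd_partial_sum \<sigma> \<psi> \<phi> r = (\<lambda>z. \<Sum>k=1..r. \<sigma> k * tensor (\<psi> k) (\<phi> k) z)"

text \<open>
  Indices start at 1; the entries at index 0 are never used. The singular functions are
  unconstrained at indices with \<open>\<sigma> k = 0\<close>, where their terms vanish; this covers finite rank.
\<close>

definition is_L2_SVD ::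
    "real set \<Rightarrow> real set \<Rightarrow> (real \<times> real \<Rightarrow> real) \<Rightarrow>
     (nat \<Rightarrow> real) \<Rightarrow> (nat \<Rightarrow> real \<Rightarrow> real) \<Rightarrow> (nat \<Rightarrow> real \<Rightarrow> real) \<Rightarrow> bool" where
  "is_L2_SVD \<Omega>1 \<Omega>2 u \<sigma> \<psi> \<phi> \<longleftrightarrow>
     u \<in> L2 (\<Omega>1 \<times> \<Omega>2) \<and>
     (\<forall>k\<ge>1. 0 \<le> \<sigma> k) \<and> (\<forall>k\<ge>1. \<sigma> (k + 1) \<le> \<sigma> k) \<and>
     L2_orthonormal \<Omega>1 {k. 1 \<le> k \<and> 0 < \<sigma> k} \<psi> \<and>
     L2_orthonormal \<Omega>2 {k. 1 \<le> k \<and> 0 < \<sigma> k} \<phi> \<and>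
     (\<lambda>r. L2_norm (\<Omega>1 \<times> \<Omega>2) (\<lambda>z. u z - svd_partial_sum \<sigma> \<psi> \<phi> r z)) \<longlonglongrightarrow> 0"

end

theory Submission
  imports Defs
begin

text \<open>
  Let \<open>v = \<partial>\<^sub>x u\<close>. The idea is that differentiating the singular value expansion of \<open>u\<close> in \<open>x\<close> leaves
  the right singular functions alone, so the system \<open>\<phi> k\<close> stays orthonormal and Pythagoras
  still applies, although the functions \<open>\<psi>' k\<close> are in general no longer orthogonal to one another.
  Terms with \<open>\<sigma> k = 0\<close> vanish, so only \<open>k\<close> with \<open>\<sigma> k > 0\<close> are considered here.

  Integrating \<open>u\<close> against \<open>\<phi> k\<close> in the variable \<open>y\<close> gives \<open>\<sigma> k * \<psi> k\<close>, and this integration commutes with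
  the weak derivative in \<open>x\<close> (\<open>has_weak_partial_contract\<close>). Hence \<open>\<psi> k\<close> is weakly differentiable,
  and integrating \<open>v\<close> against \<open>\<phi> k\<close> gives \<open>\<sigma> k * \<psi>' k\<close> (\<open>L2_inner_v_tensor_\<phi>\<close>). So
  \<open>v\<^sub>r = (\<Sum>k=1..r. \<sigma> k * \<psi>' k \<otimes> \<phi> k)\<close>, which is the weak derivative of \<open>u\<^sub>r\<close>, is the orthogonal projection
  of \<open>v\<close> onto \<open>L2 \<Omega>1 \<otimes> span {\<phi> 1, ..., \<phi> r}\<close>. By Pythagoras its squared norm is the sum of
  \<open>(\<sigma> k)\<^sup>2 * \<parallel>\<psi>' k\<parallel>\<^sup>2\<close> (\<open>L2_norm_sum_tensor\<close>), and the same holds with \<open>\<psi> k\<close> in place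
  of \<open>\<psi>' k\<close>. This is the first formula.

  For the remainder one needs \<open>v\<^sub>r \<longlonglongrightarrow> v\<close> in \<open>L2\<close> (\<open>svd_partial_sum_tendsto_v\<close>). Tested against a smooth
  compactly supported \<open>\<eta>\<close>, the difference \<open>v - v\<^sub>r\<close> becomes \<open>u\<^sub>r - u\<close> tested against \<open>\<partial>\<^sub>x \<eta>\<close>, which tends
  to 0. The differences are bounded by \<open>\<parallel>v\<parallel>\<close> and test functions are dense, so \<open>v - v\<^sub>r\<close> tends to 0
  weakly in \<open>L2\<close>. As \<open>v\<^sub>r\<close> is a projection of \<open>v\<close>, \<open>\<parallel>v - v\<^sub>r\<parallel>\<^sup>2 = \<langle>v - v\<^sub>r, v\<rangle>\<close>, and weak convergence becomes
  norm convergence. The tail formula is then the limit of Pythagoras for finite blocks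
  (\<open>svd_tail_sums\<close>). The derivative in \<open>y\<close> follows by exchanging the two variables.

  The one analytic tool is the density of test functions in \<open>L2\<close> (\<open>test_functions_dense_L2\<close>). It yields
  the passage to weak limits above, the uniqueness of weak derivatives, and the fact that \<open>\<phi> k\<close>,
  which is merely square integrable, may be used in the role of a test function in \<open>y\<close>.
\<close>

section \<open>Square integrable functions\<close>

text \<open>
  Functions stand for their classes, so \<open>L2_norm\<close> is only a seminorm. Equality almost everywhere is
  therefore expressed by \<open>L2_norm \<Omega> (\<lambda>x. f x - g x) = 0\<close>; by Cauchy--Schwarz such \<open>f\<close> and \<open>g\<close> have the
  same inner products.
\<close>

lemma L2_measurable: "f \<in> L2 \<Omega> \<Longrightarrow> f \<in> borel_measurable (lborel_on \<Omega>)"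
  by (simp add: L2_def)

lemma L2_square_integrable: "f \<in> L2 \<Omega> \<Longrightarrow> integrable (lborel_on \<Omega>) (\<lambda>x. (f x)\<^sup>2)"
  by (simp add: L2_def)

lemma L2_mult_integrable:
  assumes "f \<in> L2 \<Omega>" "g \<in> L2 \<Omega>"
  shows "integrable (lborel_on \<Omega>) (\<lambda>x. f x * g x)"
proof (rule Bochner_Integration.integrable_bound)
  show "integrable (lborel_on \<Omega>) (\<lambda>x. (f x)\<^sup>2 + (g x)\<^sup>2)"
    using assms by (auto dest: L2_square_integrable)
  show "(\<lambda>x. f x * g x) \<in> borel_measurable (lborel_on \<Omega>)"
    using assms[THEN L2_measurable] by measurable
  have "\<bar>a * b\<bar> \<le> a\<^sup>2 + b\<^sup>2" for a b :: real
    using sum_squares_bound[of "\<bar>a\<bar>" "\<bar>b\<bar>"] abs_ge_zero[of "a * b"]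
    unfolding abs_mult power2_abs by linarith
  then show "AE x in lborel_on \<Omega>. norm (f x * g x) \<le> norm ((f x)\<^sup>2 + (g x)\<^sup>2)"
    by simp
qed

lemma L2_add:
  assumes "f \<in> L2 \<Omega>" "g \<in> L2 \<Omega>"
  shows "(\<lambda>x. f x + g x) \<in> L2 \<Omega>"
proof -
  have "integrable (lborel_on \<Omega>) (\<lambda>x. (f x)\<^sup>2 + (g x)\<^sup>2 + 2 * (f x * g x))"
    using assms by (intro Bochner_Integration.integrable_add integrable_mult_right
        L2_square_integrable L2_mult_integrable)
  then show ?thesis
    using assms[THEN L2_measurable] by (auto simp: L2_def power2_sum algebra_simps)
qed

lemma L2_cmult: "f \<in> L2 \<Omega> \<Longrightarrow> (\<lambda>x. c * f x) \<in> L2 \<Omega>"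
  by (auto simp: L2_def power_mult_distrib)

lemma L2_uminus: "f \<in> L2 \<Omega> \<Longrightarrow> (\<lambda>x. - f x) \<in> L2 \<Omega>"
  using L2_cmult[of f \<Omega> "-1"] by simp

lemma L2_diff: "f \<in> L2 \<Omega> \<Longrightarrow> g \<in> L2 \<Omega> \<Longrightarrow> (\<lambda>x. f x - g x) \<in> L2 \<Omega>"
  using L2_add[OF _ L2_uminus, of f \<Omega> g] by simp

lemma L2_zero: "(\<lambda>x. 0) \<in> L2 \<Omega>"
  by (simp add: L2_def)

lemma L2_sum: "(\<And>i. i \<in> I \<Longrightarrow> f i \<in> L2 \<Omega>) \<Longrightarrow> (\<lambda>x. \<Sum>i\<in>I. f i x) \<in> L2 \<Omega>"
  by (induction I rule: infinite_finite_induct) (auto intro: L2_zero L2_add)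

lemma L2_inner_commute: "L2_inner \<Omega> f g = L2_inner \<Omega> g f"
  by (simp add: L2_inner_def mult.commute)

lemma L2_inner_add_left:
  "f \<in> L2 \<Omega> \<Longrightarrow> g \<in> L2 \<Omega> \<Longrightarrow> h \<in> L2 \<Omega> \<Longrightarrow>
    L2_inner \<Omega> (\<lambda>x. f x + g x) h = L2_inner \<Omega> f h + L2_inner \<Omega> g h"
  by (simp add: L2_inner_def distrib_right L2_mult_integrable)

lemma L2_inner_diff_left:
  "f \<in> L2 \<Omega> \<Longrightarrow> g \<in> L2 \<Omega> \<Longrightarrow> h \<in> L2 \<Omega> \<Longrightarrow>
    L2_inner \<Omega> (\<lambda>x. f x - g x) h = L2_inner \<Omega> f h - L2_inner \<Omega> g h"
  by (simp add: L2_inner_def left_diff_distrib L2_mult_integrable)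

lemma L2_inner_cmult_left: "L2_inner \<Omega> (\<lambda>x. c * f x) h = c * L2_inner \<Omega> f h"
  by (simp add: L2_inner_def mult.assoc)

lemma L2_inner_sum_left:
  assumes "\<And>i. i \<in> I \<Longrightarrow> f i \<in> L2 \<Omega>" "h \<in> L2 \<Omega>"
  shows "L2_inner \<Omega> (\<lambda>x. \<Sum>i\<in>I. f i x) h = (\<Sum>i\<in>I. L2_inner \<Omega> (f i) h)"
  using assms
  by (induction I rule: infinite_finite_induct)
     (auto simp: L2_inner_add_left L2_sum, auto simp: L2_inner_def)

lemma L2_inner_add_right:
  "f \<in> L2 \<Omega> \<Longrightarrow> g \<in> L2 \<Omega> \<Longrightarrow> h \<in> L2 \<Omega> \<Longrightarrow>
    L2_inner \<Omega> h (\<lambda>x. f x + g x) = L2_inner \<Omega> h f + L2_inner \<Omega> h g"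
  using L2_inner_add_left by (simp add: L2_inner_commute[of _ h])

lemma L2_inner_diff_right:
  "f \<in> L2 \<Omega> \<Longrightarrow> g \<in> L2 \<Omega> \<Longrightarrow> h \<in> L2 \<Omega> \<Longrightarrow>
    L2_inner \<Omega> h (\<lambda>x. f x - g x) = L2_inner \<Omega> h f - L2_inner \<Omega> h g"
  using L2_inner_diff_left by (simp add: L2_inner_commute[of _ h])

lemma L2_inner_cmult_right: "L2_inner \<Omega> h (\<lambda>x. c * f x) = c * L2_inner \<Omega> h f"
  by (simp add: L2_inner_commute[of _ h] L2_inner_cmult_left)

lemma L2_inner_sum_right:
  assumes "\<And>i. i \<in> I \<Longrightarrow> f i \<in> L2 \<Omega>" "h \<in> L2 \<Omega>"
  shows "L2_inner \<Omega> h (\<lambda>x. \<Sum>i\<in>I. f i x) = (\<Sum>i\<in>I. L2_inner \<Omega> h (f i))"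
  using L2_inner_sum_left[OF assms] by (simp add: L2_inner_commute[of _ h])

lemma L2_norm_nonneg: "0 \<le> L2_norm \<Omega> f"
  by (simp add: L2_norm_def)

lemma L2_norm_power2: "(L2_norm \<Omega> f)\<^sup>2 = L2_inner \<Omega> f f"
  by (simp add: L2_norm_def L2_inner_def power2_eq_square[of "f _"])

lemma L2_norm_cmult: "L2_norm \<Omega> (\<lambda>x. c * f x) = \<bar>c\<bar> * L2_norm \<Omega> f"
  by (simp add: L2_norm_def power_mult_distrib real_sqrt_mult)

lemma L2_norm_diff_commute: "L2_norm \<Omega> (\<lambda>x. f x - g x) = L2_norm \<Omega> (\<lambda>x. g x - f x)"
  by (simp add: L2_norm_def power2_commute)

lemma L2_norm_diff_power2:
  assumes "f \<in> L2 \<Omega>" "g \<in> L2 \<Omega>"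
  shows "(L2_norm \<Omega> (\<lambda>x. f x - g x))\<^sup>2 =
    (L2_norm \<Omega> f)\<^sup>2 - 2 * L2_inner \<Omega> f g + (L2_norm \<Omega> g)\<^sup>2"
  using assms
  by (simp add: L2_norm_power2 L2_inner_diff_left L2_inner_diff_right L2_diff
      L2_inner_commute[of \<Omega> g f])

lemma L2_Cauchy_Schwarz:
  assumes f: "f \<in> L2 \<Omega>" and g: "g \<in> L2 \<Omega>"
  shows "\<bar>L2_inner \<Omega> f g\<bar> \<le> L2_norm \<Omega> f * L2_norm \<Omega> g"
proof -
  \<comment> \<open>The quadratic \<open>\<parallel>f - t g\<parallel>\<^sup>2\<close> in \<open>t\<close> is nonnegative; it is minimised at \<open>t = B / C\<close>. If \<open>C = 0\<close> it is
    affine, which forces \<open>B = 0\<close>.\<close>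
  define A B C where "A = L2_inner \<Omega> f f" and "B = L2_inner \<Omega> f g" and "C = L2_inner \<Omega> g g"
  have q: "0 \<le> A - 2 * t * B + t\<^sup>2 * C" for t
    using zero_le_power2[of "L2_norm \<Omega> (\<lambda>x. f x - t * g x)"]
    unfolding L2_norm_diff_power2[OF f L2_cmult[OF g]]
    unfolding L2_norm_power2 L2_inner_cmult_left L2_inner_cmult_right A_def B_def C_def
    by (simp add: power2_eq_square mult.assoc)
  have C0: "0 \<le> C" and A0: "0 \<le> A"
    unfolding C_def A_def by (metis L2_norm_power2 zero_le_power2)+
  have "B\<^sup>2 \<le> A * C"
  proof (cases "C = 0")
    case True
    have "B = 0"
    proof (rule ccontr)
      assume "B \<noteq> 0"
      then show False using q[of "(A + 1) / (2 * B)"] True by (simp add: field_simps)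
    qed
    then show ?thesis using True by simp
  next
    case False
    then have "0 \<le> A - B\<^sup>2 / C"
      using q[of "B / C"] by (simp add: field_simps power2_eq_square)
    then show ?thesis using False C0 by (simp add: field_simps)
  qed
  then have "B\<^sup>2 \<le> (L2_norm \<Omega> f * L2_norm \<Omega> g)\<^sup>2"
    by (simp add: power_mult_distrib L2_norm_power2 A_def C_def)
  then show ?thesis
    unfolding B_def by (simp add: L2_norm_nonneg abs_le_square_iff [symmetric])
qed

lemma L2_norm_triangle:
  assumes f: "f \<in> L2 \<Omega>" and g: "g \<in> L2 \<Omega>"
  shows "L2_norm \<Omega> (\<lambda>x. f x + g x) \<le> L2_norm \<Omega> f + L2_norm \<Omega> g"
proof (rule power2_le_imp_le)
  have "(L2_norm \<Omega> (\<lambda>x. f x + g x))\<^sup>2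
      = (L2_norm \<Omega> f)\<^sup>2 + 2 * L2_inner \<Omega> f g + (L2_norm \<Omega> g)\<^sup>2"
    using f g by (simp add: L2_norm_power2 L2_inner_add_left L2_inner_add_right L2_add
      L2_inner_commute[of \<Omega> g f])
  also have "\<dots> \<le> (L2_norm \<Omega> f + L2_norm \<Omega> g)\<^sup>2"
    using L2_Cauchy_Schwarz[OF f g] by (simp add: power2_sum)
  finally show "(L2_norm \<Omega> (\<lambda>x. f x + g x))\<^sup>2 \<le> (L2_norm \<Omega> f + L2_norm \<Omega> g)\<^sup>2" .
qed (simp add: L2_norm_nonneg)

lemma L2_norm_triangle_diff:
  assumes "f \<in> L2 \<Omega>" "g \<in> L2 \<Omega>" "h \<in> L2 \<Omega>"
  shows "L2_norm \<Omega> (\<lambda>x. f x - h x) \<le> L2_norm \<Omega> (\<lambda>x. f x - g x) + L2_norm \<Omega> (\<lambda>x. g x - h x)"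
  using L2_norm_triangle[OF L2_diff[OF assms(1,2)] L2_diff[OF assms(2,3)]] by simp

lemma tendsto_L2_inner_left:
  assumes "f \<in> L2 \<Omega>" "\<And>n. g n \<in> L2 \<Omega>" "h \<in> L2 \<Omega>"
    and lim: "(\<lambda>n. L2_norm \<Omega> (\<lambda>x. f x - g n x)) \<longlonglongrightarrow> 0"
  shows "(\<lambda>n. L2_inner \<Omega> (g n) h) \<longlonglongrightarrow> L2_inner \<Omega> f h"
proof (rule LIM_zero_cancel, rule tendsto_rabs_zero_cancel, rule tendsto_sandwich[OF _ _ tendsto_const])
  show "(\<lambda>n. L2_norm \<Omega> (\<lambda>x. f x - g n x) * L2_norm \<Omega> h) \<longlonglongrightarrow> 0"
    using tendsto_mult_right[OF lim, of "L2_norm \<Omega> h"] by simp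
  have "\<bar>L2_inner \<Omega> (g n) h - L2_inner \<Omega> f h\<bar> \<le> L2_norm \<Omega> (\<lambda>x. f x - g n x) * L2_norm \<Omega> h" for n
    using L2_Cauchy_Schwarz[OF L2_diff[OF assms(1) assms(2)] assms(3), of n] assms
    by (simp add: L2_inner_diff_left abs_minus_commute)
  then show "\<forall>\<^sub>F n in sequentially. \<bar>L2_inner \<Omega> (g n) h - L2_inner \<Omega> f h\<bar>
      \<le> L2_norm \<Omega> (\<lambda>x. f x - g n x) * L2_norm \<Omega> h"
    by simp
qed simp

section \<open>Calculus of $C^k$ functions\<close>

lemma partial_deriv_eqI:
  "(f has_derivative f') (at x) \<Longrightarrow> partial_deriv b f x = f' b"
  unfolding partial_deriv_def by (metis frechet_derivative_at)

lemma differentiable_has_partial_deriv: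
  "f differentiable_on UNIV \<Longrightarrow> (f has_derivative (\<lambda>b. partial_deriv b f x)) (at x)"
  unfolding partial_deriv_def by (simp add: differentiable_on_def frechet_derivative_works)

lemma Ck_Suc_imp: "Ck (Suc n) f \<Longrightarrow> Ck n f"
proof (induction n arbitrary: f)
  case 0
  then show ?case by (simp add: differentiable_imp_continuous_on)
next
  case (Suc n)
  then show ?case by (auto simp del: Ck.simps(1))
qed

lemma Ck_imp_continuous: "Ck n f \<Longrightarrow> continuous_on UNIV f"
  by (cases n) (auto simp: differentiable_imp_continuous_on)

lemma Ck_const: "Ck n (\<lambda>x::'a::euclidean_space. c)"
proof (induction n arbitrary: c)
  case (Suc n)
  have "partial_deriv b (\<lambda>x::'a. c) = (\<lambda>x. 0)" for b
    by (auto intro!: partial_deriv_eqI derivative_eq_intros)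
  then show ?case using Suc by simp
qed simp

lemma Ck_add: "Ck n f \<Longrightarrow> Ck n g \<Longrightarrow> Ck n (\<lambda>x. f x + g x)"
proof (induction n arbitrary: f g)
  case (Suc n)
  have "partial_deriv b (\<lambda>x. f x + g x) = (\<lambda>x. partial_deriv b f x + partial_deriv b g x)" for b
    using Suc.prems by (auto intro!: partial_deriv_eqI derivative_eq_intros differentiable_has_partial_deriv)
  then show ?case using Suc by (simp add: differentiable_on_add)
qed (simp add: continuous_on_add)

lemma Ck_mult: "Ck n f \<Longrightarrow> Ck n g \<Longrightarrow> Ck n (\<lambda>x. f x * g x)"
proof (induction n arbitrary: f g)
  case (Suc n)
  have "partial_deriv b (\<lambda>x. f x * g x) = (\<lambda>x. f x * partial_deriv b g x + partial_deriv b f x * g x)" for b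
    using Suc.prems by (auto intro!: partial_deriv_eqI derivative_eq_intros differentiable_has_partial_deriv)
  then show ?case
    using Suc Ck_Suc_imp[OF Suc.prems(1)] Ck_Suc_imp[OF Suc.prems(2)]
    by (simp add: differentiable_on_mult Ck_add)
qed (simp add: continuous_on_mult)

lemma Ck_sum: "(\<And>i. i \<in> I \<Longrightarrow> Ck n (f i)) \<Longrightarrow> Ck n (\<lambda>x. \<Sum>i\<in>I. f i x)"
  by (induction I rule: infinite_finite_induct) (auto intro: Ck_const Ck_add)

lemma Ck_prod: "(\<And>i. i \<in> I \<Longrightarrow> Ck n (f i)) \<Longrightarrow> Ck n (\<lambda>x. \<Prod>i\<in>I. f i x)"
  by (induction I rule: infinite_finite_induct) (auto intro: Ck_const Ck_mult)

text \<open>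
  Slices, projections to a factor, the exchange of the two variables and the substitutions
  \<open>x \<mapsto> c * (x \<bullet> i) + d\<close> are all affine. One chain rule for affine maps therefore covers every composition
  that occurs below.
\<close>

lemma partial_deriv_compose_affine:
  assumes "f differentiable_on UNIV" "bounded_linear L"
  shows "((\<lambda>x. f (L x + d)) has_derivative (\<lambda>b. partial_deriv (L b) f (L x + d))) (at x)"
proof -
  interpret L: bounded_linear L by fact
  have "((\<lambda>x. L x + d) has_derivative L) (at x)"
    using has_derivative_add_const[OF bounded_linear_imp_has_derivative[OF assms(2)]] .
  from diff_chain_at[OF this differentiable_has_partial_deriv[OF assms(1)]]
  show ?thesis by (simp add: o_def)
qed

lemma Ck_compose_affine:
  fixes f :: "'a::euclidean_space \<Rightarrow> real" and L :: "'b::euclidean_space \<Rightarrow> 'a"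
  assumes "bounded_linear L" "Ck n f"
  shows "Ck n (\<lambda>x. f (L x + d))"
  using assms(2)
proof (induction n arbitrary: f)
  case 0
  interpret L: bounded_linear L by fact
  have "continuous_on UNIV (\<lambda>x. L x + d)"
    by (intro continuous_intros L.continuous_on)
  then show ?case using 0 by (auto intro: continuous_on_compose2)
next
  case (Suc n)
  then have f: "f differentiable_on UNIV" by simp
  have pd: "partial_deriv b (\<lambda>x. f (L x + d)) =
      (\<lambda>x. \<Sum>i\<in>Basis. (L b \<bullet> i) * partial_deriv i f (L x + d))" for b
  proof
    fix x
    interpret D: bounded_linear "\<lambda>b. partial_deriv b f (L x + d)"
      using differentiable_has_partial_deriv[OF f] by (rule has_derivative_bounded_linear)
    have "partial_deriv b (\<lambda>x. f (L x + d)) x = partial_deriv (L b) f (L x + d)"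
      using partial_deriv_compose_affine[OF f assms(1)] by (rule partial_deriv_eqI)
    also have "\<dots> = partial_deriv (\<Sum>i\<in>Basis. (L b \<bullet> i) *\<^sub>R i) f (L x + d)"
      by (simp add: euclidean_representation)
    also have "\<dots> = (\<Sum>i\<in>Basis. (L b \<bullet> i) * partial_deriv i f (L x + d))"
      by (simp add: D.sum D.scaleR)
    finally show "partial_deriv b (\<lambda>x. f (L x + d)) x =
      (\<Sum>i\<in>Basis. (L b \<bullet> i) * partial_deriv i f (L x + d))" .
  qed
  have "(\<lambda>x. f (L x + d)) differentiable_on UNIV"
    using partial_deriv_compose_affine[OF f assms(1)]
    by (auto simp: differentiable_on_def differentiable_def)
  then show ?case
    using Suc unfolding Ck.simps pd by (auto intro!: Ck_sum Ck_mult Ck_const)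
qed


section \<open>A smooth step\<close>

text \<open>
  The function \<open>exp (- 1 / t)\<close>, extended by 0 to \<open>t \<le> 0\<close>, with a polynomial factor in \<open>1 / t\<close>. The factor
  makes the family closed under differentiation, so that smoothness is a plain induction.
\<close>

definition exp_step :: "real poly \<Rightarrow> real \<Rightarrow> real" where
  "exp_step p t = (if t \<le> 0 then 0 else poly p (1 / t) * exp (- (1 / t)))"

lemma tendsto_poly_div_exp_at_top:
  "((\<lambda>x. poly p x * exp (- x)) \<longlongrightarrow> 0) (at_top :: real filter)"
proof -
  have "((\<lambda>x::real. \<Sum>i\<le>degree p. coeff p i * (x ^ i / exp x)) \<longlongrightarrow> (\<Sum>i\<le>degree p. coeff p i * 0)) at_top"
    by (intro tendsto_sum tendsto_mult tendsto_const tendsto_power_div_exp_0)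
  then show ?thesis
    by (simp add: poly_altdef exp_minus sum_divide_distrib field_simps)
qed

text \<open>
  The factor of the derivative comes from \<open>(p (1 / t) * exp (- 1 / t))' = (1 / t)\<^sup>2 * (p - p') (1 / t) * exp (- 1 / t)\<close>.
  At 0 the difference quotient is again of the form \<open>q (1 / t) * exp (- 1 / t)\<close> and tends to 0, as the
  exponential beats every polynomial.
\<close>

lemma has_real_derivative_exp_step:
  "(exp_step p has_real_derivative exp_step ([:0, 0, 1:] * (p - pderiv p)) t) (at t)"
proof -
  consider "t < 0" | "t = 0" | "t > 0" by linarith
  then show ?thesis
  proof cases
    case 1
    have "((\<lambda>x. 0) has_real_derivative 0) (at t)" by simp
    then have "(exp_step p has_real_derivative 0) (at t)"
      by (rule has_field_derivative_transform_within_open[of _ _ _ "{..<0}"])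
         (use 1 in \<open>auto simp: exp_step_def\<close>)
    then show ?thesis using 1 by (simp add: exp_step_def)
  next
    case 2
    have "((\<lambda>h. exp_step p h / h) \<longlongrightarrow> 0) (at 0)"
    proof (rule filterlim_split_at)
      have "\<forall>\<^sub>F h in at_left 0. exp_step p h / h = 0"
        by (auto simp: eventually_at_filter exp_step_def)
      then show "((\<lambda>h. exp_step p h / h) \<longlongrightarrow> 0) (at_left 0)"
        by (rule tendsto_eventually)
      have "((\<lambda>h. poly ([:0, 1:] * p) (inverse h) * exp (- inverse h)) \<longlongrightarrow> 0) (at_right (0::real))"
        by (rule filterlim_compose[OF tendsto_poly_div_exp_at_top filterlim_inverse_at_top_right])
      moreover have "\<forall>\<^sub>F h in at_right 0.
          poly ([:0, 1:] * p) (inverse h) * exp (- inverse h) = exp_step p h / h"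
        by (auto simp: eventually_at_filter exp_step_def field_simps)
      ultimately show "((\<lambda>h. exp_step p h / h) \<longlongrightarrow> 0) (at_right 0)"
        by (rule Lim_transform_eventually)
    qed
    then show ?thesis using 2 by (simp add: DERIV_def exp_step_def)
  next
    case 3
    have "((\<lambda>x. poly p (1 / x) * exp (- (1 / x))) has_real_derivative
        exp_step ([:0, 0, 1:] * (p - pderiv p)) t) (at t)"
      using 3 by (auto intro!: derivative_eq_intros DERIV_chain2[OF poly_DERIV]
          simp: exp_step_def power2_eq_square field_simps)
    then show ?thesis
      by (rule has_field_derivative_transform_within_open[of _ _ _ "{0<..}"])
         (use 3 in \<open>auto simp: exp_step_def\<close>)
  qed
qed

lemma Ck_exp_step: "Ck n (exp_step p)"
proof (induction n arbitrary: p)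
  case 0
  then show ?case
    using DERIV_isCont[OF has_real_derivative_exp_step]
    by (simp add: continuous_at_imp_continuous_on)
next
  case (Suc n)
  have D: "(exp_step p has_derivative (*) (exp_step ([:0, 0, 1:] * (p - pderiv p)) t)) (at t)" for t
    using has_real_derivative_exp_step by (simp add: has_field_derivative_def)
  have "partial_deriv 1 (exp_step p) = exp_step ([:0, 0, 1:] * (p - pderiv p))"
    using partial_deriv_eqI[OF D] by auto
  moreover have "exp_step p differentiable_on UNIV"
    using D by (auto simp: differentiable_on_def differentiable_def)
  ultimately show ?case using Suc by simp
qed

section \<open>Test functions\<close>

text \<open>
  Having some compact set in \<open>\<Omega>\<close> outside of which the function vanishes is easier to verify than a
  statement about the closed support, and equivalent to it.
\<close>

lemma test_function_support:
  assumes "\<And>n. Ck n \<eta>" "compact K" "K \<subseteq> \<Omega>" "\<And>x. x \<notin> K \<Longrightarrow> \<eta> x = 0"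
  shows "test_function \<Omega> \<eta>"
proof -
  have "closure {x. \<eta> x \<noteq> 0} \<subseteq> K"
    using assms by (intro closure_minimal compact_imp_closed) auto
  moreover from this have "compact (closure {x. \<eta> x \<noteq> 0})"
    using assms(2) compact_Int_closed[of K "closure {x. \<eta> x \<noteq> 0}"] by (simp add: Int_absorb1)
  ultimately show ?thesis using assms unfolding test_function_def by blast
qed

lemma test_functionE:
  assumes "test_function \<Omega> \<eta>"
  obtains K where "compact K" "K \<subseteq> \<Omega>" "\<And>x. x \<notin> K \<Longrightarrow> \<eta> x = 0" "\<And>n. Ck n \<eta>"
  using assms closure_subset[of "{x. \<eta> x \<noteq> 0}"] unfolding test_function_def by blast

lemma test_function_zero: "test_function \<Omega> (\<lambda>x. 0)"
  by (rule test_function_support[of _ "{}"]) (auto intro: Ck_const)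

lemma test_function_add:
  assumes "test_function \<Omega> \<eta>" "test_function \<Omega> \<zeta>"
  shows "test_function \<Omega> (\<lambda>x. \<eta> x + \<zeta> x)"
proof -
  obtain K where K: "compact K" "K \<subseteq> \<Omega>" "\<And>x. x \<notin> K \<Longrightarrow> \<eta> x = 0" "\<And>n. Ck n \<eta>"
    using test_functionE[OF assms(1)] by metis
  obtain K' where K': "compact K'" "K' \<subseteq> \<Omega>" "\<And>x. x \<notin> K' \<Longrightarrow> \<zeta> x = 0" "\<And>n. Ck n \<zeta>"
    using test_functionE[OF assms(2)] by metis
  show ?thesis
    by (rule test_function_support[of _ "K \<union> K'"]) (use K K' in \<open>auto intro: Ck_add\<close>)
qed

lemma test_function_cmult:
  assumes "test_function \<Omega> \<eta>"
  shows "test_function \<Omega> (\<lambda>x. c * \<eta> x)"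
proof -
  obtain K where K: "compact K" "K \<subseteq> \<Omega>" "\<And>x. x \<notin> K \<Longrightarrow> \<eta> x = 0" "\<And>n. Ck n \<eta>"
    using test_functionE[OF assms(1)] by metis
  show ?thesis
    by (rule test_function_support[of _ K]) (use K in \<open>auto intro: Ck_mult Ck_const\<close>)
qed

lemma test_function_partial_deriv:
  assumes "test_function \<Omega> \<eta>" "b \<in> Basis"
  shows "test_function \<Omega> (partial_deriv b \<eta>)"
proof -
  obtain K where K: "compact K" "K \<subseteq> \<Omega>" "\<And>x. x \<notin> K \<Longrightarrow> \<eta> x = 0" "\<And>n. Ck n \<eta>"
    using test_functionE[OF assms(1)] by metis
  show ?thesis
  proof (rule test_function_support[of _ K])
    show "Ck n (partial_deriv b \<eta>)" for n
      using K(4)[of "Suc n"] assms(2) by simp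
    show "partial_deriv b \<eta> x = 0" if "x \<notin> K" for x
    proof -
      have "((\<lambda>x. 0) has_derivative (\<lambda>_. 0)) (at x)" by simp
      then have "(\<eta> has_derivative (\<lambda>_. 0)) (at x)"
        by (rule has_derivative_transform_within_open[of _ _ _ _ "- K"])
          (use K that in \<open>auto simp: compact_imp_closed open_Compl\<close>)
      then show ?thesis by (rule partial_deriv_eqI)
    qed
  qed (use K in auto)
qed

lemma test_function_in_L2:
  assumes "open \<Omega>" "test_function \<Omega> \<eta>"
  shows "\<eta> \<in> L2 \<Omega>"
proof -
  obtain K where K: "compact K" "K \<subseteq> \<Omega>" "\<And>x. x \<notin> K \<Longrightarrow> \<eta> x = 0" "\<And>n. Ck n \<eta>"
    using test_functionE[OF assms(2)] by metis
  have c: "continuous_on UNIV \<eta>" using K(4) by (rule Ck_imp_continuous)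
  then have "\<eta> \<in> borel_measurable borel"
    by (rule borel_measurable_continuous_onI)
  then have m: "\<eta> \<in> borel_measurable (lborel_on \<Omega>)"
    by (intro measurable_restrict_space1) simp
  have "continuous_on K (\<lambda>x. (\<eta> x)\<^sup>2)"
    using c by (intro continuous_intros) (auto intro: continuous_on_subset)
  from borel_integrable_compact[OF K(1) this]
  have "integrable lborel (\<lambda>x. indicator K x *\<^sub>R (\<eta> x)\<^sup>2)" .
  also have "(\<lambda>x. indicator K x *\<^sub>R (\<eta> x)\<^sup>2) = (\<lambda>x. indicator \<Omega> x *\<^sub>R (\<eta> x)\<^sup>2)"
    using K by (auto simp: indicator_def fun_eq_iff)
  finally show ?thesis
    using m assms(1) by (simp add: L2_def integrable_restrict_space)
qed

text \<open>
  Since \<open>\<bar>f - s n\<bar> \<le> 2 * \<bar>g\<bar>\<close>, dominated convergence applies to \<open>(f - s n)\<^sup>2\<close> with the bound \<open>4 * g\<^sup>2\<close>.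
\<close>

lemma L2_dominated_convergence:
  assumes g: "g \<in> L2 \<Omega>" and s: "\<And>n. s n \<in> borel_measurable (lborel_on \<Omega>)"
    and f: "f \<in> borel_measurable (lborel_on \<Omega>)" and sp: "\<Omega> \<in> sets borel"
    and le: "\<And>n x. x \<in> \<Omega> \<Longrightarrow> \<bar>s n x\<bar> \<le> \<bar>g x\<bar>"
    and lim: "\<And>x. x \<in> \<Omega> \<Longrightarrow> (\<lambda>n. s n x) \<longlonglongrightarrow> f x"
  shows "f \<in> L2 \<Omega>" "\<And>n. s n \<in> L2 \<Omega>" "(\<lambda>n. L2_norm \<Omega> (\<lambda>x. f x - s n x)) \<longlonglongrightarrow> 0"
proof -
  note g2 = L2_square_integrable[OF g]
  have sp': "space (lborel_on \<Omega>) = \<Omega>" by (simp add: space_restrict_space)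
  have fg: "\<bar>f x\<bar> \<le> \<bar>g x\<bar>" if "x \<in> \<Omega>" for x
    using tendsto_rabs[OF lim[OF that]] le[OF that] by (intro LIMSEQ_le_const2) auto
  have dom: "h \<in> L2 \<Omega>" if "h \<in> borel_measurable (lborel_on \<Omega>)" "\<And>x. x \<in> \<Omega> \<Longrightarrow> \<bar>h x\<bar> \<le> \<bar>g x\<bar>" for h
    unfolding L2_def using that sp'
    by (auto intro!: Bochner_Integration.integrable_bound[OF g2] simp: abs_le_square_iff)
  show "f \<in> L2 \<Omega>" "\<And>n. s n \<in> L2 \<Omega>" using dom f fg s le by auto
  have "(\<lambda>n. LINT x|lborel_on \<Omega>. (f x - s n x)\<^sup>2) \<longlonglongrightarrow> (LINT x|lborel_on \<Omega>. 0)"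
  proof (rule integral_dominated_convergence)
    show "integrable (lborel_on \<Omega>) (\<lambda>x. 4 * (g x)\<^sup>2)" using g2 by simp
    show "AE x in lborel_on \<Omega>. (\<lambda>n. (f x - s n x)\<^sup>2) \<longlonglongrightarrow> 0"
    proof (rule AE_I2)
      fix x assume "x \<in> space (lborel_on \<Omega>)"
      then have "(\<lambda>n. (f x - s n x)\<^sup>2) \<longlonglongrightarrow> (f x - f x)\<^sup>2"
        using lim sp' by (intro tendsto_intros) auto
      then show "(\<lambda>n. (f x - s n x)\<^sup>2) \<longlonglongrightarrow> 0" by simp
    qed
    show "AE x in lborel_on \<Omega>. norm ((f x - s n x)\<^sup>2) \<le> 4 * (g x)\<^sup>2" for n
    proof (rule AE_I2)
      fix x assume "x \<in> space (lborel_on \<Omega>)"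
      then have "\<bar>f x - s n x\<bar> \<le> \<bar>2 * g x\<bar>"
        using fg[of x] le[of x n] sp' by auto
      then have "(f x - s n x)\<^sup>2 \<le> (2 * g x)\<^sup>2" unfolding abs_le_square_iff .
      then show "norm ((f x - s n x)\<^sup>2) \<le> 4 * (g x)\<^sup>2" by (simp add: power_mult_distrib)
    qed
  qed (use f s in measurable)
  then show "(\<lambda>n. L2_norm \<Omega> (\<lambda>x. f x - s n x)) \<longlonglongrightarrow> 0"
    unfolding L2_norm_def using tendsto_real_sqrt by fastforce
qed

text \<open>
  Smooth approximations of the indicator of \<open>box a b\<close>: as \<open>n\<close> grows, \<open>exp (- 1 / ((n + 1) * t - 1))\<close> tends to 1
  for every \<open>t > 0\<close>. The shift by 1 makes a factor vanish as soon as the distance to the corresponding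
  face is at most \<open>1 / (n + 1)\<close>, which keeps the support compact inside the open box. Thus any open
  box in \<open>\<Omega>\<close> may be used, including one that touches the boundary of \<open>\<Omega>\<close>.
\<close>

definition box_bump :: "nat \<Rightarrow> 'a::euclidean_space \<Rightarrow> 'a \<Rightarrow> 'a \<Rightarrow> real" where
  "box_bump n a b x = (\<Prod>i\<in>Basis.
     exp_step 1 (real (Suc n) * (x \<bullet> i - a \<bullet> i) - 1) *
     exp_step 1 (real (Suc n) * (b \<bullet> i - x \<bullet> i) - 1))"

lemma exp_step_1_bounds: "0 \<le> exp_step 1 t" "exp_step 1 t \<le> 1"
  by (auto simp: exp_step_def)

lemma exp_step_1_eq_0: "exp_step 1 t = 0 \<longleftrightarrow> t \<le> 0"
  by (auto simp: exp_step_def)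

lemma exp_step_1_tendsto:
  assumes "t > 0"
  shows "(\<lambda>n. exp_step 1 (real (Suc n) * t - 1)) \<longlonglongrightarrow> 1"
proof -
  have at: "filterlim (\<lambda>n. real (Suc n) * t - 1) at_top sequentially"
    using filterlim_tendsto_add_at_top[OF tendsto_const[of "-1"]
        filterlim_at_top_mult_tendsto_pos[OF tendsto_const[of t] assms
          filterlim_compose[OF filterlim_real_sequentially filterlim_Suc]]]
    by (simp add: algebra_simps)
  then have "(\<lambda>n. exp (- (1 / (real (Suc n) * t - 1)))) \<longlonglongrightarrow> exp (- 0)"
    by (intro tendsto_intros tendsto_divide_0[OF tendsto_const] filterlim_at_top_imp_at_infinity)
  moreover have "\<forall>\<^sub>F n in sequentially.
      exp (- (1 / (real (Suc n) * t - 1))) = exp_step 1 (real (Suc n) * t - 1)"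
    using filterlim_at_top_dense[THEN iffD1, OF at, rule_format, of 0]
    by eventually_elim (auto simp: exp_step_def)
  ultimately show ?thesis
    using Lim_transform_eventually by fastforce
qed

lemma Ck_box_bump: "Ck k (box_bump n a (b::'a::euclidean_space))"
proof -
  have 1: "bounded_linear (\<lambda>x::'a. real (Suc n) * (x \<bullet> i))"
    and 2: "bounded_linear (\<lambda>x::'a. - real (Suc n) * (x \<bullet> i))" for i
    by (intro bounded_linear_intros)+
  have "Ck k (\<lambda>x. exp_step 1 (real (Suc n) * (x \<bullet> i) + (- real (Suc n) * (a \<bullet> i) - 1)))"
    and "Ck k (\<lambda>x. exp_step 1 (- real (Suc n) * (x \<bullet> i) + (real (Suc n) * (b \<bullet> i) - 1)))" for i
    by (rule Ck_compose_affine[OF 1 Ck_exp_step] Ck_compose_affine[OF 2 Ck_exp_step])+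
  then show ?thesis
    unfolding box_bump_def[abs_def] by (auto intro!: Ck_prod Ck_mult simp: algebra_simps)
qed

lemma test_function_box_bump:
  fixes a b :: "'a::euclidean_space"
  assumes "box a b \<subseteq> \<Omega>"
  shows "test_function \<Omega> (box_bump n a b)"
proof (rule test_function_support)
  let ?d = "(1 / real (Suc n)) *\<^sub>R (One::'a)"
  show "cbox (a + ?d) (b - ?d) \<subseteq> \<Omega>"
  proof -
    have pos: "0 < 1 / real (Suc n)" by simp
    have "a \<bullet> i < x \<bullet> i \<and> x \<bullet> i < b \<bullet> i"
      if "x \<in> cbox (a + ?d) (b - ?d)" "i \<in> Basis" for x i
    proof -
      have "a \<bullet> i + 1 / real (Suc n) \<le> x \<bullet> i \<and> x \<bullet> i \<le> b \<bullet> i - 1 / real (Suc n)"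
        using bspec[OF that(1)[unfolded mem_box] that(2)] that(2)
        by (simp add: inner_simps del: of_nat_Suc)
      then show ?thesis using pos by linarith
    qed
    then have "cbox (a + ?d) (b - ?d) \<subseteq> box a b" by (auto simp: mem_box)
    then show ?thesis using assms by blast
  qed
  show "box_bump n a b x = 0" if "x \<notin> cbox (a + ?d) (b - ?d)" for x
  proof -
    from that obtain i where i: "i \<in> Basis"
      "\<not> (a \<bullet> i + 1 / real (Suc n) \<le> x \<bullet> i \<and> x \<bullet> i \<le> b \<bullet> i - 1 / real (Suc n))"
      by (auto simp: mem_box inner_simps)
    then have "real (Suc n) * (x \<bullet> i - a \<bullet> i) - 1 \<le> 0 \<or> real (Suc n) * (b \<bullet> i - x \<bullet> i) - 1 \<le> 0"
      by (simp add: field_simps del: of_nat_Suc) argo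
    then show ?thesis
      using i(1) by (auto simp: box_bump_def exp_step_1_eq_0 simp del: of_nat_Suc)
  qed
qed (auto intro: Ck_box_bump)

lemma box_bump_le_indicator:
  fixes a :: "'a::euclidean_space"
  shows "\<bar>box_bump n a b x\<bar> \<le> indicator (box a b) x"
proof (cases "x \<in> box a b")
  case True
  then show ?thesis
    unfolding box_bump_def abs_prod
    by (auto intro!: prod_le_1 mult_le_one simp: abs_mult exp_step_1_bounds)
next
  case False
  then have "box_bump n a b x = 0"
    using test_functionE[OF test_function_box_bump[OF order_refl, of a b n]] by (metis subsetD)
  then show ?thesis by simp
qed

lemma box_bump_tendsto:
  fixes a :: "'a::euclidean_space"
  shows "(\<lambda>n. box_bump n a b x) \<longlonglongrightarrow> indicator (box a b) x"
proof (cases "x \<in> box a b")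
  case True
  then have "(\<lambda>n. box_bump n a b x) \<longlonglongrightarrow> (\<Prod>i\<in>(Basis::'a set). 1 * 1)"
    unfolding box_bump_def
    by (intro tendsto_prod tendsto_mult exp_step_1_tendsto) (auto simp: mem_box)
  then show ?thesis using True by simp
next
  case False
  then have "box_bump n a b x = 0" for n
    using box_bump_le_indicator[of n a b x] by simp
  then show ?thesis using False by simp
qed

section \<open>Density of test functions\<close>

text \<open>
  The closure of the test functions in \<open>L2\<close>. It is a closed subspace, and the following lemmas show
  that it contains indicators of boxes, then of Borel sets, then all of \<open>L2\<close>.
\<close>

definition test_approximable :: "'a::euclidean_space set \<Rightarrow> ('a \<Rightarrow> real) \<Rightarrow> bool" where
  "test_approximable \<Omega> f \<longleftrightarrow> f \<in> L2 \<Omega> \<and>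
     (\<forall>e>0. \<exists>\<eta>. test_function \<Omega> \<eta> \<and> L2_norm \<Omega> (\<lambda>x. f x - \<eta> x) < e)"

context
  fixes \<Omega> :: "'a::euclidean_space set"
  assumes open_\<Omega>: "open \<Omega>"
begin

lemma test_approximable_test_function: "test_function \<Omega> \<eta> \<Longrightarrow> test_approximable \<Omega> \<eta>"
  unfolding test_approximable_def
  using test_function_in_L2[OF open_\<Omega>] by (auto intro!: exI[of _ \<eta>] simp: L2_norm_def)

lemma test_approximable_add:
  assumes "test_approximable \<Omega> f" "test_approximable \<Omega> g"
  shows "test_approximable \<Omega> (\<lambda>x. f x + g x)"
proof -
  have fg: "f \<in> L2 \<Omega>" "g \<in> L2 \<Omega>" using assms by (auto simp: test_approximable_def)
  have "\<exists>\<theta>. test_function \<Omega> \<theta> \<and> L2_norm \<Omega> (\<lambda>x. (f x + g x) - \<theta> x) < e" if "e > 0" for e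
  proof -
    from that have "e / 2 > 0" by simp
    then obtain \<eta> \<zeta> where *: "test_function \<Omega> \<eta>" "L2_norm \<Omega> (\<lambda>x. f x - \<eta> x) < e / 2"
      "test_function \<Omega> \<zeta>" "L2_norm \<Omega> (\<lambda>x. g x - \<zeta> x) < e / 2"
      using assms unfolding test_approximable_def by blast
    have "L2_norm \<Omega> (\<lambda>x. (f x - \<eta> x) + (g x - \<zeta> x)) < e"
      using L2_norm_triangle[OF L2_diff[OF fg(1) test_function_in_L2[OF open_\<Omega> *(1)]]
          L2_diff[OF fg(2) test_function_in_L2[OF open_\<Omega> *(3)]]] *(2,4) by linarith
    then show ?thesis
      using test_function_add[OF *(1,3)] by (intro exI[of _ "\<lambda>x. \<eta> x + \<zeta> x"]) (simp add: algebra_simps)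
  qed
  then show ?thesis using fg by (auto simp: test_approximable_def L2_add)
qed

lemma test_approximable_cmult:
  assumes "test_approximable \<Omega> f"
  shows "test_approximable \<Omega> (\<lambda>x. c * f x)"
proof -
  have "\<exists>\<theta>. test_function \<Omega> \<theta> \<and> L2_norm \<Omega> (\<lambda>x. c * f x - \<theta> x) < e" if "e > 0" for e
  proof -
    from that have "e / (\<bar>c\<bar> + 1) > 0" by simp
    then obtain \<eta> where *: "test_function \<Omega> \<eta>" "L2_norm \<Omega> (\<lambda>x. f x - \<eta> x) < e / (\<bar>c\<bar> + 1)"
      using assms unfolding test_approximable_def by blast
    then have "(\<bar>c\<bar> + 1) * L2_norm \<Omega> (\<lambda>x. f x - \<eta> x) < e"
      by (simp add: field_simps)
    then have "\<bar>c\<bar> * L2_norm \<Omega> (\<lambda>x. f x - \<eta> x) < e"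
      using L2_norm_nonneg[of \<Omega> "\<lambda>x. f x - \<eta> x"] by (simp add: algebra_simps)
    then have "L2_norm \<Omega> (\<lambda>x. c * f x - c * \<eta> x) < e"
      using L2_norm_cmult[of \<Omega> c "\<lambda>x. f x - \<eta> x"] by (simp add: algebra_simps)
    then show ?thesis
      using test_function_cmult[OF *(1)] by blast
  qed
  then show ?thesis using assms by (auto simp: test_approximable_def L2_cmult)
qed

lemma test_approximable_diff:
  "test_approximable \<Omega> f \<Longrightarrow> test_approximable \<Omega> g \<Longrightarrow> test_approximable \<Omega> (\<lambda>x. f x - g x)"
  using test_approximable_add[OF _ test_approximable_cmult[of g "-1"], of f] by simp

lemma test_approximable_limit:
  assumes "\<And>n. test_approximable \<Omega> (s n)" "f \<in> L2 \<Omega>"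
    and lim: "(\<lambda>n. L2_norm \<Omega> (\<lambda>x. f x - s n x)) \<longlonglongrightarrow> 0"
  shows "test_approximable \<Omega> f"
proof -
  have "\<exists>\<eta>. test_function \<Omega> \<eta> \<and> L2_norm \<Omega> (\<lambda>x. f x - \<eta> x) < e" if "e > 0" for e
  proof -
    from that have e: "e / 2 > 0" by simp
    obtain n where n: "L2_norm \<Omega> (\<lambda>x. f x - s n x) < e / 2"
      using order_tendstoD(2)[OF lim e] by (auto simp: eventually_sequentially)
    obtain \<eta> where *: "test_function \<Omega> \<eta>" "L2_norm \<Omega> (\<lambda>x. s n x - \<eta> x) < e / 2"
      using assms(1)[of n] e unfolding test_approximable_def by blast
    have "L2_norm \<Omega> (\<lambda>x. f x - \<eta> x) < e"
      using L2_norm_triangle_diff[OF assms(2) _ test_function_in_L2[OF open_\<Omega> *(1)], of "s n"]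
        assms(1)[of n] n *(2) unfolding test_approximable_def by linarith
    then show ?thesis using *(1) by blast
  qed
  then show ?thesis using assms(2) by (auto simp: test_approximable_def)
qed

lemma test_approximable_dominated:
  assumes "\<And>n. test_approximable \<Omega> (s n)" "g \<in> L2 \<Omega>" "f \<in> borel_measurable (lborel_on \<Omega>)"
    and "\<And>n x. x \<in> \<Omega> \<Longrightarrow> \<bar>s n x\<bar> \<le> \<bar>g x\<bar>" "\<And>x. x \<in> \<Omega> \<Longrightarrow> (\<lambda>n. s n x) \<longlonglongrightarrow> f x"
  shows "test_approximable \<Omega> f"
proof -
  have "s n \<in> borel_measurable (lborel_on \<Omega>)" for n
    using assms(1)[of n] by (auto simp: test_approximable_def L2_def)
  note * = L2_dominated_convergence[OF assms(2) this assms(3) borel_open[OF open_\<Omega>] assms(4,5)]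
  show ?thesis
    by (rule test_approximable_limit[OF assms(1)]) (use * in auto)
qed

lemma test_approximable_box:
  assumes "box a b \<subseteq> \<Omega>"
  shows "test_approximable \<Omega> (indicator (box a b))"
proof (rule test_approximable_dominated)
  show m: "indicator (box a b) \<in> borel_measurable (lborel_on \<Omega>)"
    by (intro measurable_restrict_space1) simp
  have "integrable lborel (indicator (box a b) :: 'a \<Rightarrow> real)"
    using emeasure_bounded_finite[OF bounded_box, of a b] by (simp add: integrable_indicator_iff)
  moreover have "indicator (box a b) = (\<lambda>x. indicator \<Omega> x *\<^sub>R (indicator (box a b) x)\<^sup>2 :: real)"
    using assms by (auto simp: indicator_def fun_eq_iff)
  ultimately have "integrable lborel (\<lambda>x. indicator \<Omega> x *\<^sub>R (indicator (box a b) x)\<^sup>2 :: real)"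
    by metis
  then show "indicator (box a b) \<in> L2 \<Omega>"
    using m open_\<Omega> by (simp add: L2_def integrable_restrict_space)
  show "test_approximable \<Omega> (box_bump n a b)" for n
    by (intro test_approximable_test_function test_function_box_bump assms)
qed (use box_bump_le_indicator box_bump_tendsto in auto)

text \<open>
  Boxes form an intersection-stable generator of the Borel sets, so it is enough that the sets
  with this property form a Dynkin system. Intersecting with one fixed box in \<open>\<Omega>\<close> keeps all indicators
  square integrable, with that of the box as a common dominating function.
\<close>

lemma test_approximable_borel_Int_box:
  assumes "A \<in> sets borel" and "box a b \<subseteq> \<Omega>"
  shows "test_approximable \<Omega> (indicator (A \<inter> box a b))"
proof -
  have "Int_stable (range (\<lambda>(a, b). box a b :: 'a set))"
    by (auto simp: Int_stable_def box_Int_box)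
  moreover have "range (\<lambda>(a, b). box a b :: 'a set) \<subseteq> Pow UNIV" by simp
  moreover have "A \<in> sigma_sets UNIV (range (\<lambda>(a, b). box a b :: 'a set))"
    using assms(1) by (simp add: borel_eq_box)
  ultimately show ?thesis
  proof (induction rule: sigma_sets_induct_disjoint)
    case (basic A)
    then obtain c d where "A = box c d" by auto
    then obtain p q where "A \<inter> box a b = box p q" by (auto simp: box_Int_box)
    then show ?case using assms(2) by (metis Int_lower2 order_trans test_approximable_box)
  next
    case empty
    then show ?case using test_approximable_test_function[OF test_function_zero] by simp
  next
    case (compl A)
    have "(indicator ((UNIV - A) \<inter> box a b) :: 'a \<Rightarrow> real) =
        (\<lambda>x. indicator (box a b) x - indicator (A \<inter> box a b) x)"
      by (auto simp: indicator_def)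
    then show ?case
      using test_approximable_diff[OF test_approximable_box[OF assms(2)] compl(2)] by simp
  next
    case (union A)
    let ?s = "\<lambda>n x. \<Sum>i<n. indicator (A i \<inter> box a b) x :: real"
    have s: "?s n x = indicator ((\<Union>i<n. A i) \<inter> box a b) x" for n x
    proof -
      have "disjoint_family_on (\<lambda>i. A i \<inter> box a b) {..<n}"
        using union(1) by (auto simp: disjoint_family_on_def)
      then have "(indicator (\<Union>i<n. A i \<inter> box a b) x :: real) = ?s n x"
        by (intro indicator_UN_disjoint) auto
      then show ?thesis by simp
    qed
    have "test_approximable \<Omega> (?s n)" for n
    proof (induction n)
      case 0
      then show ?case using test_approximable_test_function[OF test_function_zero] by simp
    next
      case (Suc n)
      then show ?case using test_approximable_add[OF Suc union(3)] by simp
    qed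
    then show ?case
    proof (rule test_approximable_dominated)
      show "indicator (box a b) \<in> L2 \<Omega>"
        using test_approximable_box[OF assms(2)] by (simp add: test_approximable_def)
      have "A i \<in> sets borel" for i
        using union(2) by (auto simp: borel_eq_box)
      then have "(\<Union>i. A i) \<in> sets borel"
        by (intro sets.countable_UN) auto
      then show "indicator (\<Union>(range A) \<inter> box a b) \<in> borel_measurable (lborel_on \<Omega>)"
        by (intro measurable_restrict_space1) simp
      show "\<bar>?s n x\<bar> \<le> \<bar>indicator (box a b) x\<bar>" for n x
        unfolding s by (auto simp: indicator_def)
      have "(\<lambda>n. indicator (\<Union>i<n. A i \<inter> box a b) x :: real) \<longlonglongrightarrow> indicator (\<Union>i. A i \<inter> box a b) x" for x
        by (rule LIMSEQ_indicator_UN)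
      then show "(\<lambda>n. ?s n x) \<longlonglongrightarrow> indicator (\<Union>(range A) \<inter> box a b) x" for x
        unfolding s by simp
    qed
  qed
qed

text \<open>
  The open set \<open>\<Omega>\<close> is a countable union of open boxes \<open>B i\<close>. The part of \<open>A\<close> in the first \<open>n\<close> boxes splits
  into disjoint pieces that each lie in a single box, and these parts exhaust \<open>A\<close>.
\<close>

lemma test_approximable_indicator:
  assumes A: "A \<in> sets borel" "A \<subseteq> \<Omega>" "indicator A \<in> L2 \<Omega>"
  shows "test_approximable \<Omega> (indicator A)"
proof -
  obtain \<D> where D: "countable \<D>" "\<And>X. X \<in> \<D> \<Longrightarrow> X \<subseteq> \<Omega> \<and> (\<exists>a b. X = box a b)" "\<Union>\<D> = \<Omega>"
    using open_countable_Union_open_box[OF open_\<Omega>] by (metis Pow_iff subset_iff)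
  \<comment> \<open>The empty box is added because an enumeration needs a nonempty set, and \<open>\<D>\<close> is empty if \<open>\<Omega>\<close> is.\<close>
  define B where "B = from_nat_into (insert {} \<D>)"
  have B: "B n \<subseteq> \<Omega> \<and> (\<exists>a b. B n = box a b)" for n
  proof -
    have "B n \<in> insert {} \<D>" unfolding B_def by (rule from_nat_into) simp
    moreover have "{} = box (0::'a) 0" by simp
    ultimately show ?thesis using D(2) by blast
  qed
  have "\<Union>(range B) = \<Omega>"
    using D(1,3) unfolding B_def by (subst range_from_nat_into) auto
  have "test_approximable \<Omega> (indicator (A \<inter> (\<Union>i<n. B i)))" for n
  proof (induction n)
    case 0
    then show ?case using test_approximable_test_function[OF test_function_zero] by simp
  next
    case (Suc n)
    obtain a b where ab: "B n = box a b" "box a b \<subseteq> \<Omega>" using B by metis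
    have "(\<Union>i<n. B i) \<in> sets borel" using B by (metis borel_open open_UN open_box)
    then have "test_approximable \<Omega> (indicator ((A - (\<Union>i<n. B i)) \<inter> B n))"
      using A(1) ab by (metis sets.Diff test_approximable_borel_Int_box)
    moreover have "(indicator (A \<inter> (\<Union>i<Suc n. B i)) :: 'a \<Rightarrow> real) =
       (\<lambda>x. indicator (A \<inter> (\<Union>i<n. B i)) x + indicator ((A - (\<Union>i<n. B i)) \<inter> B n) x)"
      by (auto simp: indicator_def less_Suc_eq fun_eq_iff)
    ultimately show ?case using test_approximable_add[OF Suc] by simp
  qed
  then show ?thesis
  proof (rule test_approximable_dominated[OF _ A(3)])
    show "(indicator A :: 'a \<Rightarrow> real) \<in> borel_measurable (lborel_on \<Omega>)" using A(3) by (rule L2_measurable)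
    have "(\<lambda>n. indicator (\<Union>i<n. A \<inter> B i) x :: real) \<longlonglongrightarrow> indicator (\<Union>i. A \<inter> B i) x" for x
      by (rule LIMSEQ_indicator_UN)
    moreover have "(\<Union>i. A \<inter> B i) = A" using \<open>\<Union>(range B) = \<Omega>\<close> A(2) by blast
    ultimately show "(\<lambda>n. indicator (A \<inter> (\<Union>i<n. B i)) x :: real) \<longlonglongrightarrow> indicator A x" for x
      by simp
  qed (auto simp: indicator_def)
qed

text \<open>
  The square integrability is part of the claim that is proved by induction: it has to be passed
  on to the functions that build up \<open>f\<close>, which holds as they are nonnegative and bounded by \<open>f\<close>.
\<close>

lemma test_approximable_nonneg:
  assumes "f \<in> borel_measurable (lborel_on \<Omega>)" "\<And>x. 0 \<le> f x"
  shows "f \<in> L2 \<Omega> \<longrightarrow> test_approximable \<Omega> f"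
  using assms
proof (induction rule: borel_measurable_induct_real)
  case (set A)
  then have "A \<in> sets borel" "A \<subseteq> \<Omega>"
    using open_\<Omega> by (auto simp: sets_restrict_space)
  then show ?case using test_approximable_indicator by blast
next
  case (mult f c)
  show ?case
  proof
    assume "(\<lambda>x. c * f x) \<in> L2 \<Omega>"
    from L2_cmult[OF this, of "1 / c"] have "f \<in> L2 \<Omega>" if "c \<noteq> 0" using that by simp
    then show "test_approximable \<Omega> (\<lambda>x. c * f x)"
      using mult test_approximable_cmult[of f c]
        test_approximable_test_function[OF test_function_zero] by (cases "c = 0") auto
  qed
next
  case (add f g)
  show ?case
  proof
    assume fg: "(\<lambda>x. g x + f x) \<in> L2 \<Omega>"
    have "f \<in> L2 \<Omega>" "g \<in> L2 \<Omega>"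
      using L2_square_integrable[OF fg] add
      by (auto simp: L2_def intro!: Bochner_Integration.integrable_bound[of _ "\<lambda>x. (g x + f x)\<^sup>2"] power_mono)
    then show "test_approximable \<Omega> (\<lambda>x. g x + f x)" using add test_approximable_add by blast
  qed
next
  case (seq U)
  show ?case
  proof
    assume f: "f \<in> L2 \<Omega>"
    have lim: "(\<lambda>i. U i x) \<longlonglongrightarrow> f x" if "x \<in> \<Omega>" for x
      using seq.hyps(4) that by (simp add: space_restrict_space)
    have le: "\<bar>U i x\<bar> \<le> \<bar>f x\<bar>" if "x \<in> \<Omega>" for i x
      using incseq_le[OF _ lim[OF that], of i] seq.hyps(2,3) that
      by (auto simp: incseq_def le_fun_def abs_of_nonneg assms(2))
    have "U i \<in> L2 \<Omega>" for i
      using L2_dominated_convergence(2)[of f \<Omega> U f, OF f seq.hyps(1) L2_measurable[OF f] _ le lim] open_\<Omega>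
      by auto
    then have "test_approximable \<Omega> (U i)" for i using seq by blast
    then show "test_approximable \<Omega> f"
      using f L2_measurable[OF f] le lim by (rule test_approximable_dominated)
  qed
qed

text \<open>
  Positive and negative part are nonnegative elements of \<open>L2\<close>, hence both approximable.
\<close>

theorem test_functions_dense_L2:
  assumes "f \<in> L2 \<Omega>" "e > 0"
  obtains \<eta> where "test_function \<Omega> \<eta>" "L2_norm \<Omega> (\<lambda>x. f x - \<eta> x) < e"
proof -
  have m: "f \<in> borel_measurable (lborel_on \<Omega>)" using assms(1) by (rule L2_measurable)
  have "(\<lambda>x. max 0 (f x)) \<in> L2 \<Omega>" "(\<lambda>x. max 0 (- f x)) \<in> L2 \<Omega>"
    using L2_square_integrable[OF assms(1)] m
    by (auto simp: L2_def max_def intro!: Bochner_Integration.integrable_bound[of _ "\<lambda>x. (f x)\<^sup>2"])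
  then have "test_approximable \<Omega> (\<lambda>x. max 0 (f x) - max 0 (- f x))"
    using m by (intro test_approximable_diff test_approximable_nonneg[rule_format]) auto
  moreover have "(\<lambda>x. max 0 (f x) - max 0 (- f x)) = f" by (auto simp: max_def)
  ultimately show ?thesis using assms(2) that by (auto simp: test_approximable_def)
qed

end

section \<open>Square integrable functions on products\<close>

lemma space_lborel_on: "space (lborel_on \<Omega>) = \<Omega>"
  by (simp add: space_restrict_space)

lemma sigma_finite_lborel_on:
  "\<Omega> \<in> sets borel \<Longrightarrow> sigma_finite_measure (lborel_on \<Omega>)"
  by (intro sigma_finite_measure_restrict_space) (auto simp: lborel.sigma_finite_measure_axioms)

text \<open>
  Tonelli's and Fubini's theorems speak about the product of two measures, so Lebesgue measure on
  \<open>\<Omega>1 \<times> \<Omega>2\<close> has to be recognised as such a product. For the inclusion of the restricted Borel sets in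
  the product sigma-algebra, one pulls them back along the measurable inclusion map.
\<close>

lemma lborel_on_Times:
  fixes \<Omega>1 :: "'a::euclidean_space set" and \<Omega>2 :: "'b::euclidean_space set"
  assumes [measurable]: "\<Omega>1 \<in> sets borel" "\<Omega>2 \<in> sets borel"
  shows "lborel_on \<Omega>1 \<Otimes>\<^sub>M lborel_on \<Omega>2 = lborel_on (\<Omega>1 \<times> \<Omega>2)"
proof (rule pair_measure_eqI)
  have prod: "\<Omega>1 \<times> \<Omega>2 \<in> sets (borel :: ('a \<times> 'b) measure)"
    by (simp add: borel_prod [symmetric])
  have times: "A \<times> B \<in> sets (borel :: ('a \<times> 'b) measure)" if "A \<in> sets borel" "B \<in> sets borel"
    for A :: "'a set" and B :: "'b set"
    using that by (simp add: borel_prod [symmetric])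
  show "sets (lborel_on \<Omega>1 \<Otimes>\<^sub>M lborel_on \<Omega>2) = sets (lborel_on (\<Omega>1 \<times> \<Omega>2))"
  proof
    show "sets (lborel_on \<Omega>1 \<Otimes>\<^sub>M lborel_on \<Omega>2) \<subseteq> sets (lborel_on (\<Omega>1 \<times> \<Omega>2))"
      unfolding sets_pair_measure
    proof (rule sigma_algebra.sigma_sets_subset')
      show "sigma_algebra (space (lborel_on \<Omega>1) \<times> space (lborel_on \<Omega>2)) (sets (lborel_on (\<Omega>1 \<times> \<Omega>2)))"
        using sets.sigma_algebra_axioms[of "lborel_on (\<Omega>1 \<times> \<Omega>2)"] by (simp add: space_lborel_on)
    next
      show "{A \<times> B |A B. A \<in> sets (lborel_on \<Omega>1) \<and> B \<in> sets (lborel_on \<Omega>2)} \<subseteq> sets (lborel_on (\<Omega>1 \<times> \<Omega>2))"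
        using assms prod times by (auto simp: sets_restrict_space_iff)
    next
      show "space (lborel_on \<Omega>1) \<times> space (lborel_on \<Omega>2) \<in> sets (lborel_on (\<Omega>1 \<times> \<Omega>2))"
        using sets.top[of "lborel_on (\<Omega>1 \<times> \<Omega>2)"] by (simp add: space_lborel_on)
    qed
    show "sets (lborel_on (\<Omega>1 \<times> \<Omega>2)) \<subseteq> sets (lborel_on \<Omega>1 \<Otimes>\<^sub>M lborel_on \<Omega>2)"
    proof
      fix C assume "C \<in> sets (lborel_on (\<Omega>1 \<times> \<Omega>2))"
      then have C: "C \<in> sets (borel \<Otimes>\<^sub>M borel)" "C \<subseteq> \<Omega>1 \<times> \<Omega>2"
        using prod by (auto simp: sets_restrict_space_iff borel_prod [symmetric])
      have "(\<lambda>z. (fst z, snd z)) \<in> measurable (lborel_on \<Omega>1 \<Otimes>\<^sub>M lborel_on \<Omega>2) (borel \<Otimes>\<^sub>M borel)"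
      proof (rule measurable_Pair)
        have "(\<lambda>x. x) \<in> measurable (lborel_on \<Omega>1) borel" "(\<lambda>x. x) \<in> measurable (lborel_on \<Omega>2) borel"
          by (auto intro!: measurable_restrict_space1)
        then show "fst \<in> measurable (lborel_on \<Omega>1 \<Otimes>\<^sub>M lborel_on \<Omega>2) borel"
          "snd \<in> measurable (lborel_on \<Omega>1 \<Otimes>\<^sub>M lborel_on \<Omega>2) borel"
          using measurable_compose[OF measurable_fst] measurable_compose[OF measurable_snd] by blast+
      qed
      from measurable_sets[OF this C(1)] C(2)
      show "C \<in> sets (lborel_on \<Omega>1 \<Otimes>\<^sub>M lborel_on \<Omega>2)"
        by (simp add: space_pair_measure space_lborel_on vimage_def Int_absorb2)
    qed
  qed
  fix A B assume "A \<in> sets (lborel_on \<Omega>1)" "B \<in> sets (lborel_on \<Omega>2)"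
  then have A: "A \<in> sets borel" "A \<subseteq> \<Omega>1" and B: "B \<in> sets borel" "B \<subseteq> \<Omega>2"
    by (auto simp: sets_restrict_space_iff)
  have "emeasure (lborel_on \<Omega>1) A * emeasure (lborel_on \<Omega>2) B = emeasure lborel A * emeasure lborel B"
    using A B by (simp add: emeasure_restrict_space)
  also have "\<dots> = emeasure (lborel \<Otimes>\<^sub>M lborel) (A \<times> B)"
    using A B by (simp add: lborel.emeasure_pair_measure_Times)
  also have "\<dots> = emeasure (lborel_on (\<Omega>1 \<times> \<Omega>2)) (A \<times> B)"
    using A B prod by (subst emeasure_restrict_space) (auto simp: lborel_prod)
  finally show "emeasure (lborel_on \<Omega>1) A * emeasure (lborel_on \<Omega>2) B
      = emeasure (lborel_on (\<Omega>1 \<times> \<Omega>2)) (A \<times> B)" .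
qed (rule sigma_finite_lborel_on assms)+

text \<open>
  The operator \<open>L2 \<Omega>2 \<rightarrow> L2 \<Omega>1\<close> with integral kernel \<open>F\<close>, applied to \<open>g\<close>. It is the adjoint of \<open>f \<mapsto> f \<otimes> g\<close> as
  a function of \<open>F\<close>; see \<open>L2_inner_tensor_contract\<close>.
\<close>

definition contract :: "real set \<Rightarrow> (real \<times> real \<Rightarrow> real) \<Rightarrow> (real \<Rightarrow> real) \<Rightarrow> real \<Rightarrow> real" where
  "contract \<Omega>2 F g x = (LINT y|lborel_on \<Omega>2. F (x, y) * g y)"

context
  fixes \<Omega>1 \<Omega>2 :: "real set"
  assumes open1: "open \<Omega>1" and open2: "open \<Omega>2"
begin

interpretation S1: sigma_finite_measure "lborel_on \<Omega>1"
  using open1 by (auto intro: sigma_finite_lborel_on)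
interpretation S2: sigma_finite_measure "lborel_on \<Omega>2"
  using open2 by (auto intro: sigma_finite_lborel_on)
interpretation P: pair_sigma_finite "lborel_on \<Omega>1" "lborel_on \<Omega>2" ..

lemma lborel_on_Times_open: "lborel_on (\<Omega>1 \<times> \<Omega>2) = lborel_on \<Omega>1 \<Otimes>\<^sub>M lborel_on \<Omega>2"
  using open1 open2 by (intro lborel_on_Times[symmetric]) auto

lemma tensor_measurable:
  assumes "f \<in> borel_measurable (lborel_on \<Omega>1)" "g \<in> borel_measurable (lborel_on \<Omega>2)"
  shows "tensor f g \<in> borel_measurable (lborel_on \<Omega>1 \<Otimes>\<^sub>M lborel_on \<Omega>2)"
  using assms unfolding tensor_def by measurable

lemma tensor_in_L2:
  assumes f: "f \<in> L2 \<Omega>1" and g: "g \<in> L2 \<Omega>2"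
  shows "tensor f g \<in> L2 (\<Omega>1 \<times> \<Omega>2)"
proof -
  note m = tensor_measurable[OF L2_measurable[OF f] L2_measurable[OF g]]
  have "integrable (lborel_on \<Omega>1 \<Otimes>\<^sub>M lborel_on \<Omega>2) (\<lambda>z. (tensor f g z)\<^sup>2)"
  proof (rule P.Fubini_integrable)
    show "(\<lambda>z. (tensor f g z)\<^sup>2) \<in> borel_measurable (lborel_on \<Omega>1 \<Otimes>\<^sub>M lborel_on \<Omega>2)"
      using m by measurable
  qed (use L2_square_integrable[OF f] L2_square_integrable[OF g] in
      \<open>auto simp: tensor_def power_mult_distrib\<close>)
  then show ?thesis using m by (simp add: L2_def lborel_on_Times_open)
qed

lemma L2_slice_measurable:
  assumes "F \<in> L2 (\<Omega>1 \<times> \<Omega>2)" "x \<in> \<Omega>1"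
  shows "(\<lambda>y. F (x, y)) \<in> borel_measurable (lborel_on \<Omega>2)"
proof -
  have [measurable]: "F \<in> borel_measurable (lborel_on \<Omega>1 \<Otimes>\<^sub>M lborel_on \<Omega>2)"
    using L2_measurable[OF assms(1)] by (simp add: lborel_on_Times_open)
  have [measurable]: "x \<in> space (lborel_on \<Omega>1)" using assms(2) by (simp add: space_lborel_on)
  show ?thesis by measurable
qed

lemma AE_L2_slice:
  assumes F: "F \<in> L2 (\<Omega>1 \<times> \<Omega>2)"
  shows "AE x in lborel_on \<Omega>1. (\<lambda>y. F (x, y)) \<in> L2 \<Omega>2"
proof -
  have "integrable (lborel_on \<Omega>1 \<Otimes>\<^sub>M lborel_on \<Omega>2) (\<lambda>z. (F z)\<^sup>2)"
    using L2_square_integrable[OF F] by (simp add: lborel_on_Times_open)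
  from P.AE_integrable_fst'[OF this] show ?thesis
    using AE_space by eventually_elim (use L2_slice_measurable[OF F] in \<open>auto simp: L2_def space_lborel_on\<close>)
qed

text \<open>
  For almost every \<open>x\<close> the slice \<open>F (x, _)\<close> is square integrable, and Cauchy--Schwarz on the slice bounds
  the square of the contraction by \<open>\<parallel>g\<parallel>\<^sup>2 * \<parallel>F (x, _)\<parallel>\<^sup>2\<close>, which is integrable in \<open>x\<close> by Fubini.
\<close>

lemma contract_in_L2:
  assumes F: "F \<in> L2 (\<Omega>1 \<times> \<Omega>2)" and g: "g \<in> L2 \<Omega>2"
  shows "contract \<Omega>2 F g \<in> L2 \<Omega>1"
proof -
  have Fm[measurable]: "F \<in> borel_measurable (lborel_on \<Omega>1 \<Otimes>\<^sub>M lborel_on \<Omega>2)"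
    using L2_measurable[OF F] by (simp add: lborel_on_Times_open)
  note gm[measurable] = L2_measurable[OF g]
  have m: "contract \<Omega>2 F g \<in> borel_measurable (lborel_on \<Omega>1)"
    unfolding contract_def[abs_def] by measurable
  have F2: "integrable (lborel_on \<Omega>1 \<Otimes>\<^sub>M lborel_on \<Omega>2) (\<lambda>z. (F z)\<^sup>2)"
    using L2_square_integrable[OF F] by (simp add: lborel_on_Times_open)
  have "integrable (lborel_on \<Omega>1) (\<lambda>x. (contract \<Omega>2 F g x)\<^sup>2)"
  proof (rule Bochner_Integration.integrable_bound)
    show "integrable (lborel_on \<Omega>1) (\<lambda>x. (L2_norm \<Omega>2 g)\<^sup>2 * (LINT y|lborel_on \<Omega>2. (F (x, y))\<^sup>2))"
      using P.integrable_fst'[OF F2] by simp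
    show "AE x in lborel_on \<Omega>1. norm ((contract \<Omega>2 F g x)\<^sup>2)
        \<le> norm ((L2_norm \<Omega>2 g)\<^sup>2 * (LINT y|lborel_on \<Omega>2. (F (x, y))\<^sup>2))"
      using AE_L2_slice[OF F]
    proof eventually_elim
      case (elim x)
      have "\<bar>contract \<Omega>2 F g x\<bar> \<le> L2_norm \<Omega>2 (\<lambda>y. F (x, y)) * L2_norm \<Omega>2 g"
        using L2_Cauchy_Schwarz[OF elim g] by (simp add: contract_def L2_inner_def)
      from power_mono[OF this, of 2] show ?case
        by (simp add: power_mult_distrib L2_norm_def mult.commute)
    qed
  qed (use m in measurable)
  then show ?thesis using m by (simp add: L2_def)
qed

lemma L2_inner_tensor_contract:
  assumes F: "F \<in> L2 (\<Omega>1 \<times> \<Omega>2)" and f: "f \<in> L2 \<Omega>1" and g: "g \<in> L2 \<Omega>2"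
  shows "L2_inner (\<Omega>1 \<times> \<Omega>2) F (tensor f g) = L2_inner \<Omega>1 (contract \<Omega>2 F g) f"
proof -
  have "integrable (lborel_on \<Omega>1 \<Otimes>\<^sub>M lborel_on \<Omega>2) (\<lambda>z. F z * tensor f g z)"
    using L2_mult_integrable[OF F tensor_in_L2[OF f g]] by (simp add: lborel_on_Times_open)
  from P.integral_fst'[OF this]
  have "L2_inner (\<Omega>1 \<times> \<Omega>2) F (tensor f g) =
      (LINT x|lborel_on \<Omega>1. LINT y|lborel_on \<Omega>2. F (x, y) * g y * f x)"
    by (simp add: L2_inner_def lborel_on_Times_open tensor_def mult_ac)
  then show ?thesis by (simp add: L2_inner_def contract_def)
qed

lemma L2_inner_tensor_tensor:
  assumes "f \<in> L2 \<Omega>1" "g \<in> L2 \<Omega>2" "f' \<in> L2 \<Omega>1" "g' \<in> L2 \<Omega>2"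
  shows "L2_inner (\<Omega>1 \<times> \<Omega>2) (tensor f g) (tensor f' g') = L2_inner \<Omega>1 f f' * L2_inner \<Omega>2 g g'"
proof -
  have "contract \<Omega>2 (tensor f g) g' = (\<lambda>x. L2_inner \<Omega>2 g g' * f x)"
    by (simp add: contract_def L2_inner_def tensor_def fun_eq_iff mult.assoc)
  then show ?thesis
    using L2_inner_tensor_contract[OF tensor_in_L2[OF assms(1,2)] assms(3,4)]
    by (simp add: L2_inner_cmult_left)
qed

lemma L2_norm_tensor:
  assumes "f \<in> L2 \<Omega>1" "g \<in> L2 \<Omega>2"
  shows "L2_norm (\<Omega>1 \<times> \<Omega>2) (tensor f g) = L2_norm \<Omega>1 f * L2_norm \<Omega>2 g"
proof -
  have "(L2_norm (\<Omega>1 \<times> \<Omega>2) (tensor f g))\<^sup>2 = (L2_norm \<Omega>1 f * L2_norm \<Omega>2 g)\<^sup>2"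
    using assms by (simp add: L2_norm_power2 L2_inner_tensor_tensor power_mult_distrib)
  then show ?thesis by (simp add: L2_norm_nonneg)
qed

lemma L2_swap:
  assumes "F \<in> L2 (\<Omega>1 \<times> \<Omega>2)"
  shows "F \<circ> prod.swap \<in> L2 (\<Omega>2 \<times> \<Omega>1)"
proof -
  have T: "lborel_on (\<Omega>2 \<times> \<Omega>1) = lborel_on \<Omega>2 \<Otimes>\<^sub>M lborel_on \<Omega>1"
    using open1 open2 by (intro lborel_on_Times[symmetric]) auto
  have [measurable]: "F \<in> borel_measurable (lborel_on \<Omega>1 \<Otimes>\<^sub>M lborel_on \<Omega>2)"
    using L2_measurable[OF assms] by (simp add: lborel_on_Times_open)
  have "integrable (lborel_on \<Omega>1 \<Otimes>\<^sub>M lborel_on \<Omega>2) (\<lambda>z. (F z)\<^sup>2)"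
    using L2_square_integrable[OF assms] by (simp add: lborel_on_Times_open)
  from P.integrable_product_swap[OF this]
  have "integrable (lborel_on (\<Omega>2 \<times> \<Omega>1)) (\<lambda>z. ((F \<circ> prod.swap) z)\<^sup>2)"
    by (simp add: T prod.swap_def case_prod_unfold o_def)
  moreover have "(\<lambda>z. F (snd z, fst z)) \<in> borel_measurable (lborel_on (\<Omega>2 \<times> \<Omega>1))"
    unfolding T by measurable
  ultimately show ?thesis by (simp add: L2_def prod.swap_def o_def)
qed

lemma integral_swap:
  fixes F :: "real \<times> real \<Rightarrow> real"
  assumes "F \<in> borel_measurable (lborel_on (\<Omega>1 \<times> \<Omega>2))"
  shows "(LINT z|lborel_on (\<Omega>2 \<times> \<Omega>1). F (prod.swap z)) = (LINT z|lborel_on (\<Omega>1 \<times> \<Omega>2). F z)"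
proof -
  have T: "lborel_on (\<Omega>2 \<times> \<Omega>1) = lborel_on \<Omega>2 \<Otimes>\<^sub>M lborel_on \<Omega>1"
    using open1 open2 by (intro lborel_on_Times[symmetric]) auto
  show ?thesis
    using P.integral_product_swap[of F] assms
    by (simp add: T lborel_on_Times_open prod.swap_def case_prod_unfold)
qed

lemma L2_norm_swap:
  assumes "F \<in> L2 (\<Omega>1 \<times> \<Omega>2)"
  shows "L2_norm (\<Omega>2 \<times> \<Omega>1) (F \<circ> prod.swap) = L2_norm (\<Omega>1 \<times> \<Omega>2) F"
proof -
  have [measurable]: "F \<in> borel_measurable (lborel_on (\<Omega>1 \<times> \<Omega>2))" by (rule L2_measurable[OF assms])
  have "(\<lambda>z. (F z)\<^sup>2) \<in> borel_measurable (lborel_on (\<Omega>1 \<times> \<Omega>2))" by measurable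
  from integral_swap[OF this] show ?thesis by (simp add: L2_norm_def)
qed

end

section \<open>Testing in $L^2$\<close>

text \<open>
  A function orthogonal to \<open>\<eta>\<close> satisfies \<open>\<parallel>h\<parallel>\<^sup>2 = \<langle>h, h - \<eta>\<rangle> \<le> \<parallel>h\<parallel> * \<parallel>h - \<eta>\<parallel>\<close>, and \<open>\<parallel>h - \<eta>\<parallel> < \<parallel>h\<parallel>\<close> for a suitable
  test function \<open>\<eta>\<close> if \<open>\<parallel>h\<parallel> > 0\<close>.
\<close>

lemma L2_norm_eq_0_if_orthogonal_to_test_functions:
  assumes "open \<Omega>" and h: "h \<in> L2 \<Omega>"
    and orth: "\<And>\<eta>. test_function \<Omega> \<eta> \<Longrightarrow> L2_inner \<Omega> h \<eta> = 0"
  shows "L2_norm \<Omega> h = 0"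
proof (rule ccontr)
  assume "L2_norm \<Omega> h \<noteq> 0"
  then have pos: "0 < L2_norm \<Omega> h" using L2_norm_nonneg[of \<Omega> h] by simp
  obtain \<eta> where \<eta>: "test_function \<Omega> \<eta>" "L2_norm \<Omega> (\<lambda>x. h x - \<eta> x) < L2_norm \<Omega> h"
    using test_functions_dense_L2[OF assms(1) h pos] .
  note \<eta>2 = test_function_in_L2[OF assms(1) \<eta>(1)]
  have "(L2_norm \<Omega> h)\<^sup>2 = L2_inner \<Omega> h (\<lambda>x. h x - \<eta> x)"
    by (simp add: L2_inner_diff_right h \<eta>2 orth[OF \<eta>(1)] L2_norm_power2)
  also have "\<dots> \<le> L2_norm \<Omega> h * L2_norm \<Omega> (\<lambda>x. h x - \<eta> x)"
    using L2_Cauchy_Schwarz[OF h L2_diff[OF h \<eta>2]] by linarith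
  also have "\<dots> < L2_norm \<Omega> h * L2_norm \<Omega> h" using \<eta>(2) pos by simp
  finally show False by (simp add: power2_eq_square)
qed

text \<open>
  A bounded sequence needs to be tested only on a dense set: replacing \<open>f\<close> by \<open>\<eta>\<close> changes the inner
  products by at most \<open>C * \<parallel>f - \<eta>\<parallel>\<close>, uniformly in \<open>n\<close>.
\<close>

lemma weak_L2_limit_if_test_functions:
  assumes "open \<Omega>" and e: "\<And>n. e n \<in> L2 \<Omega>" and f: "f \<in> L2 \<Omega>"
    and bound: "\<And>n. L2_norm \<Omega> (e n) \<le> C"
    and lim: "\<And>\<eta>. test_function \<Omega> \<eta> \<Longrightarrow> (\<lambda>n. L2_inner \<Omega> (e n) \<eta>) \<longlonglongrightarrow> 0"
  shows "(\<lambda>n. L2_inner \<Omega> (e n) f) \<longlonglongrightarrow> 0"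
proof (rule LIMSEQ_I)
  fix r :: real assume "r > 0"
  have C: "0 \<le> C" using bound[of 0] L2_norm_nonneg[of \<Omega> "e 0"] by linarith
  define d where "d = r / (2 * (C + 1))"
  have d: "d > 0" "C * d < r / 2"
    using \<open>r > 0\<close> C by (auto simp: d_def field_simps add_nonneg_pos)
  obtain \<eta> where \<eta>: "test_function \<Omega> \<eta>" "L2_norm \<Omega> (\<lambda>x. f x - \<eta> x) < d"
    using test_functions_dense_L2[OF assms(1) f d(1)] .
  note \<eta>2 = test_function_in_L2[OF assms(1) \<eta>(1)]
  obtain N where N: "\<And>n. n \<ge> N \<Longrightarrow> \<bar>L2_inner \<Omega> (e n) \<eta>\<bar> < r / 2"
    using LIMSEQ_D[OF lim[OF \<eta>(1)], of "r / 2"] \<open>r > 0\<close> by auto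
  have "norm (L2_inner \<Omega> (e n) f - 0) < r" if "n \<ge> N" for n
  proof -
    have "L2_inner \<Omega> (e n) f = L2_inner \<Omega> (e n) (\<lambda>x. f x - \<eta> x) + L2_inner \<Omega> (e n) \<eta>"
      using e f \<eta>2 by (simp add: L2_inner_diff_right)
    moreover have "\<bar>L2_inner \<Omega> (e n) (\<lambda>x. f x - \<eta> x)\<bar> \<le> L2_norm \<Omega> (e n) * L2_norm \<Omega> (\<lambda>x. f x - \<eta> x)"
      by (intro L2_Cauchy_Schwarz L2_diff e f \<eta>2)
    moreover have "\<dots> \<le> C * d"
      using \<eta>(2) bound C by (intro mult_mono) (auto simp: L2_norm_nonneg)
    ultimately show ?thesis using N[OF that] d(2) unfolding real_norm_def by linarith
  qed
  then show "\<exists>N. \<forall>n\<ge>N. norm (L2_inner \<Omega> (e n) f - 0) < r" by blast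
qed

section \<open>Weak partial derivatives\<close>

lemma has_weak_partial_iff:
  "has_weak_partial \<Omega> b f g \<longleftrightarrow> f \<in> L2 \<Omega> \<and> g \<in> L2 \<Omega> \<and>
    (\<forall>\<eta>. test_function \<Omega> \<eta> \<longrightarrow> L2_inner \<Omega> f (partial_deriv b \<eta>) = - L2_inner \<Omega> g \<eta>)"
  by (simp add: has_weak_partial_def L2_inner_def)

lemma has_weak_partial_cmult:
  "has_weak_partial \<Omega> b f g \<Longrightarrow> has_weak_partial \<Omega> b (\<lambda>x. c * f x) (\<lambda>x. c * g x)"
  by (simp add: has_weak_partial_iff L2_cmult L2_inner_cmult_left)

lemma test_function_L2_partial_deriv:
  assumes "open \<Omega>" "test_function \<Omega> \<eta>" "b \<in> Basis"
  shows "\<eta> \<in> L2 \<Omega>" "partial_deriv b \<eta> \<in> L2 \<Omega>"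
  using assms test_function_in_L2 test_function_partial_deriv by blast+

lemma has_weak_partial_diff:
  assumes "open \<Omega>" "b \<in> Basis" "has_weak_partial \<Omega> b f f'" "has_weak_partial \<Omega> b g g'"
  shows "has_weak_partial \<Omega> b (\<lambda>x. f x - g x) (\<lambda>x. f' x - g' x)"
  using assms by (simp add: has_weak_partial_iff L2_diff L2_inner_diff_left test_function_L2_partial_deriv)

lemma has_weak_partial_sum:
  assumes "open \<Omega>" "b \<in> Basis" "\<And>i. i \<in> I \<Longrightarrow> has_weak_partial \<Omega> b (f i) (f' i)"
  shows "has_weak_partial \<Omega> b (\<lambda>x. \<Sum>i\<in>I. f i x) (\<lambda>x. \<Sum>i\<in>I. f' i x)"
  using assms
  by (auto simp: has_weak_partial_iff L2_sum L2_inner_sum_left test_function_L2_partial_deriv sum_negf)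

lemma has_weak_partial_unique:
  assumes "open \<Omega>" "has_weak_partial \<Omega> b f g" "has_weak_partial \<Omega> b f h"
  shows "L2_norm \<Omega> (\<lambda>x. g x - h x) = 0"
  using assms test_function_in_L2[OF assms(1)]
  by (intro L2_norm_eq_0_if_orthogonal_to_test_functions)
    (auto simp: has_weak_partial_iff L2_diff L2_inner_diff_left)

lemma L2_inner_cong_norm_diff:
  assumes "f \<in> L2 \<Omega>" "g \<in> L2 \<Omega>" "h \<in> L2 \<Omega>" "L2_norm \<Omega> (\<lambda>x. f x - g x) = 0"
  shows "L2_inner \<Omega> f h = L2_inner \<Omega> g h"
  using L2_Cauchy_Schwarz[OF L2_diff[OF assms(1,2)] assms(3)] assms by (simp add: L2_inner_diff_left)

lemma L2_norm_cong_norm_diff: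
  assumes "f \<in> L2 \<Omega>" "g \<in> L2 \<Omega>" "L2_norm \<Omega> (\<lambda>x. f x - g x) = 0"
  shows "L2_norm \<Omega> f = L2_norm \<Omega> g"
proof -
  have "L2_inner \<Omega> f f = L2_inner \<Omega> g g"
    using L2_inner_cong_norm_diff[of f \<Omega> g f] L2_inner_cong_norm_diff[of f \<Omega> g g] assms
    by (simp add: L2_inner_commute[of \<Omega> g f])
  then have "(L2_norm \<Omega> f)\<^sup>2 = (L2_norm \<Omega> g)\<^sup>2" by (simp add: L2_norm_power2)
  then show ?thesis by (simp add: L2_norm_nonneg)
qed

lemma has_weak_partial_weak_partial:
  "has_weak_partial \<Omega> b f g \<Longrightarrow> has_weak_partial \<Omega> b f (weak_partial \<Omega> b f)"
  unfolding weak_partial_def by (rule someI[of "has_weak_partial \<Omega> b f"])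

text \<open>
  The derivative \<open>weak_partial\<close> is an unspecified choice among all weak derivatives. By uniqueness its
  norm may be computed from any of them.
\<close>

lemma L2_norm_weak_partial:
  assumes "open \<Omega>" "has_weak_partial \<Omega> b f g"
  shows "L2_norm \<Omega> (weak_partial \<Omega> b f) = L2_norm \<Omega> g"
  using has_weak_partial_unique[OF assms(1) has_weak_partial_weak_partial[OF assms(2)] assms(2)]
    has_weak_partial_weak_partial[OF assms(2)] assms(2)
  by (intro L2_norm_cong_norm_diff) (auto simp: has_weak_partial_def)

section \<open>Weak derivatives on product domains\<close>

lemma Basis_real_prod: "(Basis :: (real \<times> real) set) = {(1, 0), (0, 1)}"
  by (auto simp: Basis_prod_def)

lemma test_function_slice:
  assumes "test_function (\<Omega>1 \<times> \<Omega>2) (\<eta> :: real \<times> real \<Rightarrow> real)"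
  shows "test_function \<Omega>1 (\<lambda>x. \<eta> (x, y))"
    and "partial_deriv 1 (\<lambda>x. \<eta> (x, y)) x = partial_deriv (1, 0) \<eta> (x, y)"
proof -
  obtain K where K: "compact K" "K \<subseteq> \<Omega>1 \<times> \<Omega>2" "\<And>z. z \<notin> K \<Longrightarrow> \<eta> z = 0" "\<And>n. Ck n \<eta>"
    using test_functionE[OF assms] by metis
  have bl: "bounded_linear (\<lambda>x::real. (x, 0::real))"
    by (intro bounded_linear_Pair bounded_linear_ident bounded_linear_zero)
  have "\<eta> differentiable_on UNIV" using K(4)[of 1] by simp
  from partial_deriv_eqI[OF partial_deriv_compose_affine[OF this bl, of "(0, y)" x], where b = 1]
  show "partial_deriv 1 (\<lambda>x. \<eta> (x, y)) x = partial_deriv (1, 0) \<eta> (x, y)" by simp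
  show "test_function \<Omega>1 (\<lambda>x. \<eta> (x, y))"
  proof (rule test_function_support)
    show "Ck n (\<lambda>x. \<eta> (x, y))" for n
      using Ck_compose_affine[OF bl K(4), of n "(0, y)"] by simp
    have "closed ((UNIV :: real set) \<times> {y})" by (intro closed_Times) auto
    then show "compact (fst ` (K \<inter> UNIV \<times> {y}))"
      by (intro compact_continuous_image compact_Int_closed K(1) continuous_on_fst continuous_on_id)
    show "fst ` (K \<inter> UNIV \<times> {y}) \<subseteq> \<Omega>1" using K(2) by auto
    show "\<eta> (x, y) = 0" if "x \<notin> fst ` (K \<inter> UNIV \<times> {y})" for x
      using K(3)[of "(x, y)"] that by force
  qed
qed

lemma test_function_tensor:
  assumes "test_function \<Omega>1 \<zeta>" "test_function \<Omega>2 \<xi>"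
  shows "test_function (\<Omega>1 \<times> \<Omega>2) (tensor \<zeta> \<xi>)"
    and "partial_deriv (1, 0) (tensor \<zeta> \<xi>) = tensor (partial_deriv 1 \<zeta>) \<xi>"
proof -
  obtain K where K: "compact K" "K \<subseteq> \<Omega>1" "\<And>z. z \<notin> K \<Longrightarrow> \<zeta> z = 0" "\<And>n. Ck n \<zeta>"
    using test_functionE[OF assms(1)] by metis
  obtain L where L: "compact L" "L \<subseteq> \<Omega>2" "\<And>z. z \<notin> L \<Longrightarrow> \<xi> z = 0" "\<And>n. Ck n \<xi>"
    using test_functionE[OF assms(2)] by metis
  have t: "tensor \<zeta> \<xi> = (\<lambda>z. \<zeta> (fst z + 0) * \<xi> (snd z + 0))"
    by (auto simp: tensor_def)
  show "test_function (\<Omega>1 \<times> \<Omega>2) (tensor \<zeta> \<xi>)"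
  proof (rule test_function_support)
    show "Ck n (tensor \<zeta> \<xi>)" for n
      unfolding t by (intro Ck_mult Ck_compose_affine bounded_linear_fst bounded_linear_snd K L)
    show "compact (K \<times> L)" by (intro compact_Times K L)
    show "tensor \<zeta> \<xi> z = 0" if "z \<notin> K \<times> L" for z
      using that K(3)[of "fst z"] L(3)[of "snd z"] by (cases z) (auto simp: tensor_def)
  qed (use K(2) L(2) in auto)
  show "partial_deriv (1, 0) (tensor \<zeta> \<xi>) = tensor (partial_deriv 1 \<zeta>) \<xi>"
  proof
    fix z :: "real \<times> real"
    have d: "\<zeta> differentiable_on UNIV" "\<xi> differentiable_on UNIV" using K(4)[of 1] L(4)[of 1] by simp_all
    note has_derivative_mult[OF partial_deriv_compose_affine[OF d(1) bounded_linear_fst, of 0 z]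
        partial_deriv_compose_affine[OF d(2) bounded_linear_snd, of 0 z]]
    from partial_deriv_eqI[OF this, where b = "(1, 0)"]
    have "partial_deriv (1, 0) (tensor \<zeta> \<xi>) z =
        \<zeta> (fst z) * partial_deriv 0 \<xi> (snd z) + partial_deriv 1 \<zeta> (fst z) * \<xi> (snd z)"
      unfolding t by simp
    moreover have "partial_deriv 0 \<xi> (snd z) = 0"
      using has_derivative_bounded_linear[OF differentiable_has_partial_deriv[OF d(2)], of "snd z"]
      by (intro linear_0 bounded_linear.linear)
    ultimately show "partial_deriv (1, 0) (tensor \<zeta> \<xi>) z = tensor (partial_deriv 1 \<zeta>) \<xi> z"
      by (simp add: tensor_def case_prod_unfold)
  qed
qed

lemma test_function_swap:
  assumes "test_function (\<Omega>2 \<times> \<Omega>1) (\<eta> :: real \<times> real \<Rightarrow> real)"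
  shows "test_function (\<Omega>1 \<times> \<Omega>2) (\<eta> \<circ> prod.swap)"
    and "partial_deriv (a, b) (\<eta> \<circ> prod.swap) = partial_deriv (b, a) \<eta> \<circ> prod.swap"
proof -
  obtain K where K: "compact K" "K \<subseteq> \<Omega>2 \<times> \<Omega>1" "\<And>z. z \<notin> K \<Longrightarrow> \<eta> z = 0" "\<And>n. Ck n \<eta>"
    using test_functionE[OF assms] by metis
  have bl: "bounded_linear (prod.swap :: real \<times> real \<Rightarrow> _)"
    unfolding prod.swap_def[abs_def]
    by (intro bounded_linear_Pair bounded_linear_fst bounded_linear_snd)
  have s: "\<eta> \<circ> prod.swap = (\<lambda>z. \<eta> (prod.swap z + 0))" by auto
  show "test_function (\<Omega>1 \<times> \<Omega>2) (\<eta> \<circ> prod.swap)"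
  proof (rule test_function_support)
    show "Ck n (\<eta> \<circ> prod.swap)" for n
      unfolding s by (intro Ck_compose_affine bl K)
    show "compact (prod.swap ` K)"
      by (intro compact_continuous_image linear_continuous_on bl K)
    show "(\<eta> \<circ> prod.swap) z = 0" if "z \<notin> prod.swap ` K" for z
      using K(3)[of "prod.swap z"] that by (metis comp_apply image_eqI swap_swap)
  qed (use K in auto)
  have "\<eta> differentiable_on UNIV" using K(4)[of 1] by simp
  from partial_deriv_eqI[OF partial_deriv_compose_affine[OF this bl, of 0], where b = "(a, b)"]
  show "partial_deriv (a, b) (\<eta> \<circ> prod.swap) = partial_deriv (b, a) \<eta> \<circ> prod.swap"
    unfolding s by (auto simp: fun_eq_iff)
qed

context
  fixes \<Omega>1 \<Omega>2 :: "real set"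
  assumes open1: "open \<Omega>1" and open2: "open \<Omega>2"
begin

lemma open_product: "open (\<Omega>1 \<times> \<Omega>2)" using open1 open2 by (rule open_Times)

text \<open>
  Exchanging the variables turns every fact about the derivative in \<open>x\<close> into one about the derivative
  in \<open>y\<close>.
\<close>

lemma has_weak_partial_swap:
  assumes w: "has_weak_partial (\<Omega>1 \<times> \<Omega>2) (a, b) u v" and B: "(a, b) \<in> Basis"
  shows "has_weak_partial (\<Omega>2 \<times> \<Omega>1) (b, a) (u \<circ> prod.swap) (v \<circ> prod.swap)"
proof -
  have uv: "u \<in> L2 (\<Omega>1 \<times> \<Omega>2)" "v \<in> L2 (\<Omega>1 \<times> \<Omega>2)" using w by (auto simp: has_weak_partial_def)
  have "L2_inner (\<Omega>2 \<times> \<Omega>1) (u \<circ> prod.swap) (partial_deriv (b, a) \<eta>)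
      = - L2_inner (\<Omega>2 \<times> \<Omega>1) (v \<circ> prod.swap) \<eta>" if \<eta>: "test_function (\<Omega>2 \<times> \<Omega>1) \<eta>" for \<eta>
  proof -
    note \<eta>' = test_function_swap(1)[OF \<eta>]
    note L = test_function_L2_partial_deriv[OF open_product \<eta>' B]
    have "L2_inner (\<Omega>2 \<times> \<Omega>1) (f \<circ> prod.swap) (g \<circ> prod.swap) = L2_inner (\<Omega>1 \<times> \<Omega>2) f g"
      if "f \<in> L2 (\<Omega>1 \<times> \<Omega>2)" "g \<in> L2 (\<Omega>1 \<times> \<Omega>2)" for f g
      using integral_swap[OF open1 open2
          borel_measurable_integrable[OF L2_mult_integrable[OF that]]] by (simp add: L2_inner_def)
    note sw = this
    have "partial_deriv (b, a) \<eta> = partial_deriv (a, b) (\<eta> \<circ> prod.swap) \<circ> prod.swap"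
      unfolding test_function_swap(2)[OF \<eta>] by (simp add: fun_eq_iff)
    moreover have "\<eta> = (\<eta> \<circ> prod.swap) \<circ> prod.swap" by (simp add: fun_eq_iff)
    ultimately show ?thesis
      using w \<eta>' sw[OF uv(1) L(2)] sw[OF uv(2) L(1)] unfolding has_weak_partial_iff by metis
  qed
  then show ?thesis
    using L2_swap[OF open1 open2] uv unfolding has_weak_partial_iff by blast
qed

text \<open>
  If \<open>g\<close> is a test function \<open>\<xi>\<close>, this is the definition of the weak derivative of \<open>u\<close>, tested with \<open>\<zeta> \<otimes> \<xi>\<close>. In
  general \<open>g\<close> is an \<open>L2\<close> limit of test functions \<open>\<xi> n\<close>. Both sides of the identity are continuous in \<open>g\<close>,
  because \<open>\<parallel>f \<otimes> (g - \<xi> n)\<parallel> = \<parallel>f\<parallel> * \<parallel>g - \<xi> n\<parallel>\<close>.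
\<close>

lemma has_weak_partial_contract:
  assumes w: "has_weak_partial (\<Omega>1 \<times> \<Omega>2) (1, 0) u v" and g: "g \<in> L2 \<Omega>2"
  shows "has_weak_partial \<Omega>1 1 (contract \<Omega>2 u g) (contract \<Omega>2 v g)"
proof -
  have uv: "u \<in> L2 (\<Omega>1 \<times> \<Omega>2)" "v \<in> L2 (\<Omega>1 \<times> \<Omega>2)" using w by (auto simp: has_weak_partial_def)
  have "\<exists>\<xi>. test_function \<Omega>2 \<xi> \<and> L2_norm \<Omega>2 (\<lambda>x. g x - \<xi> x) < 1 / real (Suc n)" for n
    using test_functions_dense_L2[OF open2 g, of "1 / real (Suc n)"] by auto
  then obtain \<xi> where \<xi>: "\<And>n. test_function \<Omega>2 (\<xi> n)"
    "\<And>n. L2_norm \<Omega>2 (\<lambda>x. g x - \<xi> n x) < 1 / real (Suc n)" by metis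
  note \<xi>2 = test_function_in_L2[OF open2 \<xi>(1)]
  have \<xi>lim: "(\<lambda>n. L2_norm \<Omega>2 (\<lambda>x. g x - \<xi> n x)) \<longlonglongrightarrow> 0"
    by (rule tendsto_sandwich[OF _ _ tendsto_const lim_1_over_n[THEN LIMSEQ_Suc]])
      (use \<xi>(2) in \<open>auto simp: L2_norm_nonneg less_imp_le\<close>)
  have lim: "(\<lambda>n. L2_inner (\<Omega>1 \<times> \<Omega>2) (tensor f (\<xi> n)) F) \<longlonglongrightarrow> L2_inner (\<Omega>1 \<times> \<Omega>2) (tensor f g) F"
    if "f \<in> L2 \<Omega>1" "F \<in> L2 (\<Omega>1 \<times> \<Omega>2)" for f F
  proof (rule tendsto_L2_inner_left)
    have "(\<lambda>z. tensor f g z - tensor f (\<xi> n) z) = tensor f (\<lambda>y. g y - \<xi> n y)" for n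
      by (auto simp: tensor_def fun_eq_iff algebra_simps)
    then show "(\<lambda>n. L2_norm (\<Omega>1 \<times> \<Omega>2) (\<lambda>z. tensor f g z - tensor f (\<xi> n) z)) \<longlonglongrightarrow> 0"
      using tendsto_mult_left[OF \<xi>lim, of "L2_norm \<Omega>1 f"]
      by (simp add: L2_norm_tensor[OF open1 open2] that L2_diff g \<xi>2)
  qed (use that tensor_in_L2[OF open1 open2] g \<xi>2 in auto)
  have "L2_inner \<Omega>1 (contract \<Omega>2 u g) (partial_deriv 1 \<zeta>) = - L2_inner \<Omega>1 (contract \<Omega>2 v g) \<zeta>"
    if \<zeta>: "test_function \<Omega>1 \<zeta>" for \<zeta>
  proof -
    note L = test_function_L2_partial_deriv[OF open1 \<zeta>, of 1, simplified]
    have "L2_inner (\<Omega>1 \<times> \<Omega>2) (tensor (partial_deriv 1 \<zeta>) (\<xi> n)) u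
        = - L2_inner (\<Omega>1 \<times> \<Omega>2) (tensor \<zeta> (\<xi> n)) v" for n
      using w test_function_tensor[OF \<zeta> \<xi>(1)[of n]]
      unfolding has_weak_partial_iff by (metis L2_inner_commute)
    with lim[OF L(2) uv(1)]
    have "(\<lambda>n. - L2_inner (\<Omega>1 \<times> \<Omega>2) (tensor \<zeta> (\<xi> n)) v)
        \<longlonglongrightarrow> L2_inner (\<Omega>1 \<times> \<Omega>2) (tensor (partial_deriv 1 \<zeta>) g) u" by simp
    from LIMSEQ_unique[OF this tendsto_minus[OF lim[OF L(1) uv(2)]]]
    show ?thesis
      using L2_inner_tensor_contract[OF open1 open2 uv(1) L(2) g]
        L2_inner_tensor_contract[OF open1 open2 uv(2) L(1) g]
      by (simp add: L2_inner_commute[of "\<Omega>1 \<times> \<Omega>2"])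
  qed
  then show ?thesis
    using contract_in_L2[OF open1 open2 _ g] uv unfolding has_weak_partial_iff by blast
qed

text \<open>
  By Fubini one may integrate in \<open>x\<close> first, for fixed \<open>y\<close>; there the slice \<open>\<eta> (_, y)\<close> is a test function of
  one variable, and the weak derivative of \<open>f\<close> applies.
\<close>

lemma has_weak_partial_tensor:
  assumes w: "has_weak_partial \<Omega>1 1 f f'" and g: "g \<in> L2 \<Omega>2"
  shows "has_weak_partial (\<Omega>1 \<times> \<Omega>2) (1, 0) (tensor f g) (tensor f' g)"
proof -
  interpret S1: sigma_finite_measure "lborel_on \<Omega>1"
    using open1 by (auto intro: sigma_finite_lborel_on)
  interpret S2: sigma_finite_measure "lborel_on \<Omega>2"
    using open2 by (auto intro: sigma_finite_lborel_on)
  interpret P: pair_sigma_finite "lborel_on \<Omega>1" "lborel_on \<Omega>2" ..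
  have ff: "f \<in> L2 \<Omega>1" "f' \<in> L2 \<Omega>1" using w by (auto simp: has_weak_partial_def)
  have it: "L2_inner (\<Omega>1 \<times> \<Omega>2) (tensor h g) F
      = (LINT y|lborel_on \<Omega>2. g y * L2_inner \<Omega>1 h (\<lambda>x. F (x, y)))"
    if h: "h \<in> L2 \<Omega>1" and F: "F \<in> L2 (\<Omega>1 \<times> \<Omega>2)" for h F
  proof -
    have "integrable (lborel_on \<Omega>1 \<Otimes>\<^sub>M lborel_on \<Omega>2) (case_prod (\<lambda>x y. g y * (h x * F (x, y))))"
      using L2_mult_integrable[OF tensor_in_L2[OF open1 open2 h g] F]
      by (simp add: lborel_on_Times_open[OF open1 open2] tensor_def case_prod_unfold mult_ac)
    from P.integral_snd[OF this] show ?thesis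
      by (simp add: L2_inner_def lborel_on_Times_open[OF open1 open2] tensor_def case_prod_unfold mult_ac)
  qed
  have "L2_inner (\<Omega>1 \<times> \<Omega>2) (tensor f g) (partial_deriv (1, 0) \<eta>)
      = - L2_inner (\<Omega>1 \<times> \<Omega>2) (tensor f' g) \<eta>" if \<eta>: "test_function (\<Omega>1 \<times> \<Omega>2) \<eta>" for \<eta>
  proof -
    note L = test_function_L2_partial_deriv[OF open_product \<eta>, of "(1, 0)", unfolded Basis_real_prod, simplified]
    have "L2_inner \<Omega>1 f (\<lambda>x. partial_deriv (1, 0) \<eta> (x, y)) = - L2_inner \<Omega>1 f' (\<lambda>x. \<eta> (x, y))" for y
    proof -
      have "(\<lambda>x. partial_deriv (1, 0) \<eta> (x, y)) = partial_deriv 1 (\<lambda>x. \<eta> (x, y))"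
        using test_function_slice(2)[OF \<eta>] by auto
      then show ?thesis
        using w test_function_slice(1)[OF \<eta>] unfolding has_weak_partial_iff by metis
    qed
    then show ?thesis by (simp add: it ff L)
  qed
  then show ?thesis
    using tensor_in_L2[OF open1 open2 _ g] ff unfolding has_weak_partial_iff by blast
qed

end

section \<open>Singular value expansions\<close>

text \<open>
  Only indices with \<open>\<sigma> k > 0\<close> carry information; at the others \<open>\<psi> k\<close> and \<open>\<phi> k\<close> need not even be measurable.
  All sums are therefore first rewritten as sums over positive singular values.
\<close>

locale L2_SVD =
  fixes \<Omega>1 \<Omega>2 :: "real set" and u :: "real \<times> real \<Rightarrow> real"
    and \<sigma> :: "nat \<Rightarrow> real" and \<psi> \<phi> :: "nat \<Rightarrow> real \<Rightarrow> real"
  assumes open1: "open \<Omega>1" and open2: "open \<Omega>2"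
    and svd: "is_L2_SVD \<Omega>1 \<Omega>2 u \<sigma> \<psi> \<phi>"
begin

lemma u_L2: "u \<in> L2 (\<Omega>1 \<times> \<Omega>2)"
  using svd by (simp add: is_L2_SVD_def)

lemma \<sigma>_eq_0: "1 \<le> k \<Longrightarrow> \<not> 0 < \<sigma> k \<Longrightarrow> \<sigma> k = 0"
  using svd unfolding is_L2_SVD_def less_eq_real_def by metis

lemma \<psi>_L2: "1 \<le> k \<Longrightarrow> 0 < \<sigma> k \<Longrightarrow> \<psi> k \<in> L2 \<Omega>1"
  using svd by (simp add: is_L2_SVD_def L2_orthonormal_def)

lemma \<phi>_L2: "1 \<le> k \<Longrightarrow> 0 < \<sigma> k \<Longrightarrow> \<phi> k \<in> L2 \<Omega>2"
  using svd by (simp add: is_L2_SVD_def L2_orthonormal_def)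

lemma L2_norm_\<psi>: "1 \<le> k \<Longrightarrow> 0 < \<sigma> k \<Longrightarrow> (L2_norm \<Omega>1 (\<psi> k))\<^sup>2 = 1"
  using svd by (simp add: is_L2_SVD_def L2_orthonormal_def L2_norm_power2)

lemma L2_inner_\<phi>:
  "1 \<le> j \<Longrightarrow> 0 < \<sigma> j \<Longrightarrow> 1 \<le> k \<Longrightarrow> 0 < \<sigma> k \<Longrightarrow>
    L2_inner \<Omega>2 (\<phi> j) (\<phi> k) = (if j = k then 1 else 0)"
  using svd by (simp add: is_L2_SVD_def L2_orthonormal_def)

lemma swap: "L2_SVD \<Omega>2 \<Omega>1 (u \<circ> prod.swap) \<sigma> \<phi> \<psi>"
proof
  have s: "svd_partial_sum \<sigma> \<phi> \<psi> r = svd_partial_sum \<sigma> \<psi> \<phi> r \<circ> prod.swap" for r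
    by (auto simp: svd_partial_sum_def tensor_def mult_ac fun_eq_iff)
  have p: "svd_partial_sum \<sigma> \<psi> \<phi> r \<in> L2 (\<Omega>1 \<times> \<Omega>2)" for r
    unfolding svd_partial_sum_def
  proof (rule L2_sum)
    fix k assume k: "k \<in> {1..r}"
    show "(\<lambda>z. \<sigma> k * tensor (\<psi> k) (\<phi> k) z) \<in> L2 (\<Omega>1 \<times> \<Omega>2)"
      using k \<sigma>_eq_0[of k]
      by (cases "0 < \<sigma> k") (auto intro!: L2_cmult tensor_in_L2 open1 open2 \<psi>_L2 \<phi>_L2 simp: L2_zero)
  qed
  have n: "L2_norm (\<Omega>2 \<times> \<Omega>1) (\<lambda>z. (u \<circ> prod.swap) z - svd_partial_sum \<sigma> \<phi> \<psi> r z) =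
      L2_norm (\<Omega>1 \<times> \<Omega>2) (\<lambda>z. u z - svd_partial_sum \<sigma> \<psi> \<phi> r z)" for r
    using L2_norm_swap[OF open1 open2 L2_diff[OF u_L2 p[of r]]] by (simp add: s o_def)
  show "is_L2_SVD \<Omega>2 \<Omega>1 (u \<circ> prod.swap) \<sigma> \<phi> \<psi>"
    using svd L2_swap[OF open1 open2 u_L2] unfolding is_L2_SVD_def n by blast
qed (rule open1 open2)+

lemma svd_partial_sum_positive:
  "svd_partial_sum \<sigma> a \<phi> r = (\<lambda>z. \<Sum>k\<in>{k\<in>{1..r}. 0 < \<sigma> k}. \<sigma> k * tensor (a k) (\<phi> k) z)"
proof
  fix z
  have "\<sigma> k * tensor (a k) (\<phi> k) z = 0" if "k \<in> {1..r} - {k\<in>{1..r}. 0 < \<sigma> k}" for k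
    using that \<sigma>_eq_0[of k] by simp
  then show "svd_partial_sum \<sigma> a \<phi> r z = (\<Sum>k\<in>{k\<in>{1..r}. 0 < \<sigma> k}. \<sigma> k * tensor (a k) (\<phi> k) z)"
    unfolding svd_partial_sum_def by (intro sum.mono_neutral_right) auto
qed

text \<open>
  The left factors \<open>a k\<close> below are arbitrary, so that the results apply to the expansion of \<open>u\<close> with
  \<open>a = \<psi>\<close> and to that of its derivative with \<open>a = \<psi>'\<close>.
\<close>

context
  fixes a :: "nat \<Rightarrow> real \<Rightarrow> real"
  assumes a_L2: "\<And>k. 1 \<le> k \<Longrightarrow> 0 < \<sigma> k \<Longrightarrow> a k \<in> L2 \<Omega>1"
begin

lemma term_L2: "1 \<le> k \<Longrightarrow> 0 < \<sigma> k \<Longrightarrow> (\<lambda>z. \<sigma> k * tensor (a k) (\<phi> k) z) \<in> L2 (\<Omega>1 \<times> \<Omega>2)"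
  by (intro L2_cmult tensor_in_L2 open1 open2 a_L2 \<phi>_L2)

lemma svd_partial_sum_L2: "svd_partial_sum \<sigma> a \<phi> r \<in> L2 (\<Omega>1 \<times> \<Omega>2)"
  unfolding svd_partial_sum_positive by (rule L2_sum) (auto intro: term_L2)

text \<open>
  Orthonormality of the right factors alone makes the products \<open>a k \<otimes> \<phi> k\<close> orthogonal.
\<close>

lemma L2_norm_sum_tensor:
  assumes J: "finite J" "\<And>k. k \<in> J \<Longrightarrow> 1 \<le> k \<and> 0 < \<sigma> k"
  shows "(L2_norm (\<Omega>1 \<times> \<Omega>2) (\<lambda>z. \<Sum>k\<in>J. \<sigma> k * tensor (a k) (\<phi> k) z))\<^sup>2 =
    (\<Sum>k\<in>J. (\<sigma> k)\<^sup>2 * (L2_norm \<Omega>1 (a k))\<^sup>2)"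
proof -
  have L: "(\<lambda>z. \<sigma> k * tensor (a k) (\<phi> k) z) \<in> L2 (\<Omega>1 \<times> \<Omega>2)" if "k \<in> J" for k
    using term_L2 J(2)[OF that] by blast
  have "(L2_norm (\<Omega>1 \<times> \<Omega>2) (\<lambda>z. \<Sum>k\<in>J. \<sigma> k * tensor (a k) (\<phi> k) z))\<^sup>2 =
      (\<Sum>j\<in>J. \<Sum>k\<in>J. L2_inner (\<Omega>1 \<times> \<Omega>2) (\<lambda>z. \<sigma> j * tensor (a j) (\<phi> j) z)
        (\<lambda>z. \<sigma> k * tensor (a k) (\<phi> k) z))"
    unfolding L2_norm_power2
    by (subst L2_inner_sum_left) (auto simp: L L2_inner_sum_right L2_sum)
  also have "\<dots> = (\<Sum>j\<in>J. \<Sum>k\<in>J. if j = k then (\<sigma> k)\<^sup>2 * (L2_norm \<Omega>1 (a k))\<^sup>2 else 0)"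
    using J(2) by (intro sum.cong refl)
      (auto simp: L2_inner_cmult_left L2_inner_cmult_right L2_inner_tensor_tensor open1 open2
        a_L2 \<phi>_L2 L2_inner_\<phi> L2_norm_power2 power2_eq_square[of "\<sigma> _"])
  also have "\<dots> = (\<Sum>k\<in>J. (\<sigma> k)\<^sup>2 * (L2_norm \<Omega>1 (a k))\<^sup>2)"
    using J(1) by (simp add: sum.delta)
  finally show ?thesis .
qed

lemma L2_norm_svd_partial_sum_diff:
  assumes "r \<le> s"
  shows "(L2_norm (\<Omega>1 \<times> \<Omega>2) (\<lambda>z. svd_partial_sum \<sigma> a \<phi> s z - svd_partial_sum \<sigma> a \<phi> r z))\<^sup>2 =
    (\<Sum>k=r+1..s. (\<sigma> k)\<^sup>2 * (L2_norm \<Omega>1 (a k))\<^sup>2)"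
proof -
  let ?K = "\<lambda>r. {k\<in>{1..r}. 0 < \<sigma> k}" and ?J = "{k\<in>{r+1..s}. 0 < \<sigma> k}"
  have "?K s = ?K r \<union> ?J" using assms by auto
  then have d: "svd_partial_sum \<sigma> a \<phi> s z - svd_partial_sum \<sigma> a \<phi> r z =
      (\<Sum>k\<in>?J. \<sigma> k * tensor (a k) (\<phi> k) z)" for z
    unfolding svd_partial_sum_positive by (simp only:) (subst sum.union_disjoint, auto)
  have "(L2_norm (\<Omega>1 \<times> \<Omega>2) (\<lambda>z. svd_partial_sum \<sigma> a \<phi> s z - svd_partial_sum \<sigma> a \<phi> r z))\<^sup>2 =
      (\<Sum>k\<in>?J. (\<sigma> k)\<^sup>2 * (L2_norm \<Omega>1 (a k))\<^sup>2)"
    unfolding d by (rule L2_norm_sum_tensor) auto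
  also have "\<dots> = (\<Sum>k=r+1..s. (\<sigma> k)\<^sup>2 * (L2_norm \<Omega>1 (a k))\<^sup>2)"
    using \<sigma>_eq_0 by (intro sum.mono_neutral_left) auto
  finally show ?thesis .
qed

lemma L2_norm_svd_partial_sum:
  "(L2_norm (\<Omega>1 \<times> \<Omega>2) (svd_partial_sum \<sigma> a \<phi> r))\<^sup>2 = (\<Sum>k=1..r. (\<sigma> k)\<^sup>2 * (L2_norm \<Omega>1 (a k))\<^sup>2)"
  using L2_norm_svd_partial_sum_diff[of 0 r] by (simp add: svd_partial_sum_def)

text \<open>
  The partial sums on the left are the squared norms of the blocks from \<open>r\<close> to \<open>r + n\<close>. By the triangle
  inequality, the norm of such a block differs from that of the remainder \<open>w - S r\<close> by at most
  \<open>\<parallel>w - S (r + n)\<parallel>\<close>.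
\<close>

lemma svd_tail_sums:
  assumes w: "w \<in> L2 (\<Omega>1 \<times> \<Omega>2)"
    and lim: "(\<lambda>s. L2_norm (\<Omega>1 \<times> \<Omega>2) (\<lambda>z. w z - svd_partial_sum \<sigma> a \<phi> s z)) \<longlonglongrightarrow> 0"
  shows "(\<lambda>j. (\<sigma> (r + 1 + j))\<^sup>2 * (L2_norm \<Omega>1 (a (r + 1 + j)))\<^sup>2)
    sums (L2_norm (\<Omega>1 \<times> \<Omega>2) (\<lambda>z. w z - svd_partial_sum \<sigma> a \<phi> r z))\<^sup>2"
proof -
  let ?N = "L2_norm (\<Omega>1 \<times> \<Omega>2)" and ?S = "svd_partial_sum \<sigma> a \<phi>"
  let ?A = "?N (\<lambda>z. w z - ?S r z)" and ?B = "\<lambda>n. ?N (\<lambda>z. ?S (r + n) z - ?S r z)"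
  let ?C = "\<lambda>n. ?N (\<lambda>z. w z - ?S (n + r) z)"
  note L = svd_partial_sum_L2
  have "?B \<longlonglongrightarrow> ?A"
  proof (rule LIM_zero_cancel, rule tendsto_rabs_zero_cancel, rule tendsto_sandwich[OF _ _ tendsto_const])
    show "?C \<longlonglongrightarrow> 0" using lim by (rule LIMSEQ_ignore_initial_segment)
    have "\<bar>?B n - ?A\<bar> \<le> ?C n" for n
      using L2_norm_triangle_diff[OF w L[of "r + n"] L[of r]]
        L2_norm_triangle_diff[OF L[of "r + n"] w L[of r]]
        L2_norm_diff_commute[of "\<Omega>1 \<times> \<Omega>2" "?S (r + n)" w]
      by (simp add: add.commute)
    then show "\<forall>\<^sub>F n in sequentially. \<bar>?B n - ?A\<bar> \<le> ?C n" by simp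
  qed simp
  then have "(\<lambda>n. (?B n)\<^sup>2) \<longlonglongrightarrow> ?A\<^sup>2" by (rule tendsto_power)
  moreover have "(?B n)\<^sup>2 = (\<Sum>j<n. (\<sigma> (r + 1 + j))\<^sup>2 * (L2_norm \<Omega>1 (a (r + 1 + j)))\<^sup>2)" for n
  proof -
    have "(\<Sum>k=r+1..r+n. f k) = (\<Sum>j<n. f (r + 1 + j))" for f :: "nat \<Rightarrow> real"
      by (induction n) auto
    then show ?thesis by (subst L2_norm_svd_partial_sum_diff) auto
  qed
  ultimately show ?thesis unfolding sums_def by simp
qed

end

text \<open>
  The truncations converge to \<open>u\<close>, and for \<open>r \<ge> k\<close> the inner product with \<open>f \<otimes> \<phi> k\<close> picks out the \<open>k\<close>-th
  term alone.
\<close>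

lemma L2_inner_u_tensor_\<phi>:
  assumes k: "1 \<le> k" "0 < \<sigma> k" and f: "f \<in> L2 \<Omega>1"
  shows "L2_inner (\<Omega>1 \<times> \<Omega>2) u (tensor f (\<phi> k)) = \<sigma> k * L2_inner \<Omega>1 (\<psi> k) f"
proof -
  let ?S = "svd_partial_sum \<sigma> \<psi> \<phi>"
  have t: "tensor f (\<phi> k) \<in> L2 (\<Omega>1 \<times> \<Omega>2)" by (intro tensor_in_L2 open1 open2 f \<phi>_L2 k)
  have "(\<lambda>r. L2_inner (\<Omega>1 \<times> \<Omega>2) (?S r) (tensor f (\<phi> k))) \<longlonglongrightarrow> L2_inner (\<Omega>1 \<times> \<Omega>2) u (tensor f (\<phi> k))"
    using svd by (intro tendsto_L2_inner_left u_L2 t svd_partial_sum_L2 \<psi>_L2) (auto simp: is_L2_SVD_def)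
  moreover have "L2_inner (\<Omega>1 \<times> \<Omega>2) (?S r) (tensor f (\<phi> k)) = \<sigma> k * L2_inner \<Omega>1 (\<psi> k) f"
    if "r \<ge> k" for r
  proof -
    have "L2_inner (\<Omega>1 \<times> \<Omega>2) (?S r) (tensor f (\<phi> k)) =
        (\<Sum>j\<in>{j\<in>{1..r}. 0 < \<sigma> j}. L2_inner (\<Omega>1 \<times> \<Omega>2) (\<lambda>z. \<sigma> j * tensor (\<psi> j) (\<phi> j) z) (tensor f (\<phi> k)))"
      unfolding svd_partial_sum_positive by (rule L2_inner_sum_left) (auto intro: term_L2 \<psi>_L2 t)
    also have "\<dots> = (\<Sum>j\<in>{j\<in>{1..r}. 0 < \<sigma> j}. if j = k then \<sigma> k * L2_inner \<Omega>1 (\<psi> k) f else 0)"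
      using k f by (intro sum.cong refl)
        (auto simp: L2_inner_cmult_left L2_inner_tensor_tensor open1 open2 \<psi>_L2 \<phi>_L2 L2_inner_\<phi>)
    also have "\<dots> = \<sigma> k * L2_inner \<Omega>1 (\<psi> k) f"
      using k that by (simp add: sum.delta)
    finally show ?thesis .
  qed
  then have "(\<lambda>r. L2_inner (\<Omega>1 \<times> \<Omega>2) (?S r) (tensor f (\<phi> k))) \<longlonglongrightarrow> \<sigma> k * L2_inner \<Omega>1 (\<psi> k) f"
    by (intro tendsto_eventually) (auto simp: eventually_sequentially)
  ultimately show ?thesis by (rule LIMSEQ_unique)
qed

end

locale L2_SVD_weak_partial = L2_SVD +
  fixes v :: "real \<times> real \<Rightarrow> real"
  assumes v: "has_weak_partial (\<Omega>1 \<times> \<Omega>2) (1, 0) u v"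
begin

abbreviation d\<psi> :: "nat \<Rightarrow> real \<Rightarrow> real" where
  "d\<psi> k \<equiv> weak_deriv \<Omega>1 (\<psi> k)"

lemma v_L2: "v \<in> L2 (\<Omega>1 \<times> \<Omega>2)"
  using v by (simp add: has_weak_partial_def)

text \<open>
  As \<open>\<psi> k\<close> is, almost everywhere, the contraction of \<open>u\<close> with \<open>\<phi> k\<close> divided by \<open>\<sigma> k\<close>, it inherits its
  derivative from \<open>v\<close>.
\<close>

lemma has_weak_partial_\<psi>_contract:
  assumes k: "1 \<le> k" "0 < \<sigma> k"
  shows "has_weak_partial \<Omega>1 1 (\<psi> k) (\<lambda>x. 1 / \<sigma> k * contract \<Omega>2 v (\<phi> k) x)"
proof -
  have "L2_inner \<Omega>1 (\<psi> k) (partial_deriv 1 \<eta>)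
      = - L2_inner \<Omega>1 (\<lambda>x. 1 / \<sigma> k * contract \<Omega>2 v (\<phi> k) x) \<eta>" if \<eta>: "test_function \<Omega>1 \<eta>" for \<eta>
  proof -
    have L: "partial_deriv 1 \<eta> \<in> L2 \<Omega>1"
      using test_function_L2_partial_deriv[OF open1 \<eta>, of 1] by simp
    have "\<sigma> k * L2_inner \<Omega>1 (\<psi> k) (partial_deriv 1 \<eta>) = - L2_inner \<Omega>1 (contract \<Omega>2 v (\<phi> k)) \<eta>"
      using has_weak_partial_contract[OF open1 open2 v \<phi>_L2[OF k]] \<eta>
        L2_inner_u_tensor_\<phi>[OF k L] L2_inner_tensor_contract[OF open1 open2 u_L2 L \<phi>_L2[OF k]]
      by (simp add: has_weak_partial_iff)
    then show ?thesis
      using k by (simp only: L2_inner_cmult_left) (simp add: field_simps)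
  qed
  then show ?thesis
    unfolding has_weak_partial_iff
    using \<psi>_L2[OF k] contract_in_L2[OF open1 open2 v_L2 \<phi>_L2[OF k]] L2_cmult by blast
qed

lemma has_weak_partial_\<psi>: "1 \<le> k \<Longrightarrow> 0 < \<sigma> k \<Longrightarrow> has_weak_partial \<Omega>1 1 (\<psi> k) (d\<psi> k)"
  using has_weak_partial_weak_partial[OF has_weak_partial_\<psi>_contract] .

lemma d\<psi>_L2: "1 \<le> k \<Longrightarrow> 0 < \<sigma> k \<Longrightarrow> d\<psi> k \<in> L2 \<Omega>1"
  using has_weak_partial_\<psi> by (auto simp: has_weak_partial_def)

lemma L2_inner_v_tensor_\<phi>:
  assumes k: "1 \<le> k" "0 < \<sigma> k" and f: "f \<in> L2 \<Omega>1"
  shows "L2_inner (\<Omega>1 \<times> \<Omega>2) v (tensor f (\<phi> k)) = \<sigma> k * L2_inner \<Omega>1 (d\<psi> k) f"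
proof -
  have "L2_inner \<Omega>1 (d\<psi> k) f = L2_inner \<Omega>1 (\<lambda>x. 1 / \<sigma> k * contract \<Omega>2 v (\<phi> k) x) f"
    using has_weak_partial_unique[OF open1 has_weak_partial_\<psi>[OF k] has_weak_partial_\<psi>_contract[OF k]]
      has_weak_partial_\<psi>_contract[OF k] d\<psi>_L2[OF k] f
    by (intro L2_inner_cong_norm_diff) (auto simp: has_weak_partial_def)
  also have "\<dots> = 1 / \<sigma> k * L2_inner \<Omega>1 (contract \<Omega>2 v (\<phi> k)) f" by (rule L2_inner_cmult_left)
  finally show ?thesis
    using k L2_inner_tensor_contract[OF open1 open2 v_L2 f \<phi>_L2[OF k]] by simp
qed

lemma has_weak_partial_svd_partial_sum:
  "has_weak_partial (\<Omega>1 \<times> \<Omega>2) (1, 0) (svd_partial_sum \<sigma> \<psi> \<phi> r) (svd_partial_sum \<sigma> d\<psi> \<phi> r)"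
  unfolding svd_partial_sum_positive
  by (intro has_weak_partial_sum has_weak_partial_cmult has_weak_partial_tensor open_Times open1 open2
      has_weak_partial_\<psi> \<phi>_L2) (auto simp: Basis_real_prod)

text \<open>
  The truncations \<open>S r = (\<Sum>k=1..r. \<sigma> k * \<psi>' k \<otimes> \<phi> k)\<close> tend weakly to \<open>v\<close>: tested against a test function,
  the derivative can be moved onto it, and the truncations of \<open>u\<close> converge. They are
  projections of \<open>v\<close>, so \<open>\<parallel>v - S r\<parallel>\<^sup>2 = \<langle>v - S r, v\<rangle>\<close>, which tends to 0 by weak convergence.
\<close>

lemma svd_partial_sum_tendsto_v:
  "(\<lambda>r. L2_norm (\<Omega>1 \<times> \<Omega>2) (\<lambda>z. v z - svd_partial_sum \<sigma> d\<psi> \<phi> r z)) \<longlonglongrightarrow> 0"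
proof -
  let ?\<Omega> = "\<Omega>1 \<times> \<Omega>2" and ?S = "svd_partial_sum \<sigma> d\<psi> \<phi>"
  let ?e = "\<lambda>r z. v z - ?S r z"
  have op: "open ?\<Omega>" using open1 open2 by (rule open_Times)
  have S: "?S r \<in> L2 ?\<Omega>" for r using d\<psi>_L2 by (rule svd_partial_sum_L2)
  have e: "?e r \<in> L2 ?\<Omega>" for r by (intro L2_diff v_L2 S)
  have vS: "L2_inner ?\<Omega> v (?S r) = (L2_norm ?\<Omega> (?S r))\<^sup>2" for r
  proof -
    have "L2_inner ?\<Omega> v (?S r) =
        (\<Sum>k\<in>{k\<in>{1..r}. 0 < \<sigma> k}. L2_inner ?\<Omega> v (\<lambda>z. \<sigma> k * tensor (d\<psi> k) (\<phi> k) z))"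
      unfolding svd_partial_sum_positive
      by (rule L2_inner_sum_right) (auto intro: term_L2 d\<psi>_L2 v_L2)
    also have "\<dots> = (\<Sum>k\<in>{k\<in>{1..r}. 0 < \<sigma> k}. (\<sigma> k)\<^sup>2 * (L2_norm \<Omega>1 (d\<psi> k))\<^sup>2)"
      by (intro sum.cong refl)
        (auto simp: L2_inner_cmult_right L2_inner_v_tensor_\<phi> d\<psi>_L2 L2_norm_power2 power2_eq_square[of "\<sigma> _"])
    also have "\<dots> = (\<Sum>k=1..r. (\<sigma> k)\<^sup>2 * (L2_norm \<Omega>1 (d\<psi> k))\<^sup>2)"
      using \<sigma>_eq_0 by (intro sum.mono_neutral_left) auto
    finally show ?thesis using L2_norm_svd_partial_sum[of d\<psi> r] d\<psi>_L2 by simp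
  qed
  have e2: "(L2_norm ?\<Omega> (?e r))\<^sup>2 = (L2_norm ?\<Omega> v)\<^sup>2 - (L2_norm ?\<Omega> (?S r))\<^sup>2"
    and ev: "L2_inner ?\<Omega> (?e r) v = (L2_norm ?\<Omega> v)\<^sup>2 - (L2_norm ?\<Omega> (?S r))\<^sup>2" for r
    using vS[of r] L2_norm_diff_power2[OF v_L2 S[of r]] L2_inner_diff_left[OF v_L2 S[of r] v_L2]
      L2_norm_power2[of ?\<Omega> v] L2_inner_commute[of ?\<Omega> "?S r" v]
    by linarith+
  have bound: "L2_norm ?\<Omega> (?e r) \<le> L2_norm ?\<Omega> v" for r
  proof (rule power2_le_imp_le)
    show "(L2_norm ?\<Omega> (?e r))\<^sup>2 \<le> (L2_norm ?\<Omega> v)\<^sup>2" unfolding e2 by simp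
  qed (rule L2_norm_nonneg)
  have "(\<lambda>r. L2_inner ?\<Omega> (?e r) \<eta>) \<longlonglongrightarrow> 0" if \<eta>: "test_function ?\<Omega> \<eta>" for \<eta>
  proof -
    note L = test_function_L2_partial_deriv[OF op \<eta>, of "(1, 0)", unfolded Basis_real_prod, simplified]
    have "(\<lambda>r. L2_inner ?\<Omega> (svd_partial_sum \<sigma> \<psi> \<phi> r) (partial_deriv (1, 0) \<eta>))
        \<longlonglongrightarrow> L2_inner ?\<Omega> u (partial_deriv (1, 0) \<eta>)"
      using svd by (intro tendsto_L2_inner_left u_L2 L svd_partial_sum_L2 \<psi>_L2) (auto simp: is_L2_SVD_def)
    from tendsto_diff[OF this tendsto_const[of "L2_inner ?\<Omega> u (partial_deriv (1, 0) \<eta>)"]]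
    show ?thesis
      using has_weak_partial_svd_partial_sum v \<eta>
      by (simp add: has_weak_partial_iff L2_inner_diff_left v_L2 S L)
  qed
  from weak_L2_limit_if_test_functions[OF op e v_L2 bound this]
  have "(\<lambda>r. (L2_norm ?\<Omega> (?e r))\<^sup>2) \<longlonglongrightarrow> 0" unfolding ev e2 .
  then have "(\<lambda>r. sqrt ((L2_norm ?\<Omega> (?e r))\<^sup>2)) \<longlonglongrightarrow> sqrt 0" by (rule tendsto_real_sqrt)
  then show ?thesis by (simp add: L2_norm_nonneg)
qed

lemma L2_norm_partial_svd_partial_sum:
  "(L2_norm (\<Omega>1 \<times> \<Omega>2) (svd_partial_sum \<sigma> d\<psi> \<phi> r))\<^sup>2 = (\<Sum>k=1..r. (\<sigma> k)\<^sup>2 * (L2_norm \<Omega>1 (d\<psi> k))\<^sup>2)"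
  using d\<psi>_L2 by (rule L2_norm_svd_partial_sum)

lemma partial_svd_tail_sums:
  "(\<lambda>j. (\<sigma> (r + 1 + j))\<^sup>2 * (L2_norm \<Omega>1 (d\<psi> (r + 1 + j)))\<^sup>2)
    sums (L2_norm (\<Omega>1 \<times> \<Omega>2) (\<lambda>z. v z - svd_partial_sum \<sigma> d\<psi> \<phi> r z))\<^sup>2"
  using d\<psi>_L2 v_L2 svd_partial_sum_tendsto_v by (rule svd_tail_sums)

end

section \<open>The $H^1$ norms of truncations and remainders\<close>

lemma H1_norm_power2:
  fixes \<Omega>1 \<Omega>2 :: "real set"
  assumes "open \<Omega>1" "open \<Omega>2" "has_weak_partial (\<Omega>1 \<times> \<Omega>2) (1, 0) f f1" "has_weak_partial (\<Omega>1 \<times> \<Omega>2) (0, 1) f f2"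
  shows "(H1_norm (\<Omega>1 \<times> \<Omega>2) f)\<^sup>2 =
    (L2_norm (\<Omega>1 \<times> \<Omega>2) f)\<^sup>2 + (L2_norm (\<Omega>1 \<times> \<Omega>2) f1)\<^sup>2 + (L2_norm (\<Omega>1 \<times> \<Omega>2) f2)\<^sup>2"
  using L2_norm_weak_partial[OF open_Times[OF assms(1,2)] assms(3)]
    L2_norm_weak_partial[OF open_Times[OF assms(1,2)] assms(4)]
  by (simp add: H1_norm_def Basis_real_prod)

theorem theorem4p1:
  fixes \<Omega>1 \<Omega>2 :: "real set"
    and u :: "real \<times> real \<Rightarrow> real"
    and \<sigma> :: "nat \<Rightarrow> real"
    and \<psi> \<phi> :: "nat \<Rightarrow> real \<Rightarrow> real"
    and ur :: "nat \<Rightarrow> real \<times> real \<Rightarrow> real"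
  assumes "open \<Omega>1" and "is_interval \<Omega>1" and "\<Omega>1 \<noteq> {}"
    and "open \<Omega>2" and "is_interval \<Omega>2" and "\<Omega>2 \<noteq> {}"
    and "u \<in> H1 (\<Omega>1 \<times> \<Omega>2)"
    and "is_L2_SVD \<Omega>1 \<Omega>2 u \<sigma> \<psi> \<phi>"
    and "\<And>r. ur r = svd_partial_sum \<sigma> \<psi> \<phi> r"
  shows "(\<forall>k\<ge>1. 0 < \<sigma> k \<longrightarrow> \<psi> k \<in> H1 \<Omega>1 \<and> \<phi> k \<in> H1 \<Omega>2) \<and>
    (\<forall>r. ur r \<in> H1 (\<Omega>1 \<times> \<Omega>2)) \<and>
    (\<forall>r. (H1_norm (\<Omega>1 \<times> \<Omega>2) (ur r))\<^sup>2 =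
      (\<Sum>k=1..r. (\<sigma> k)\<^sup>2 * (1 + (L2_norm \<Omega>1 (weak_deriv \<Omega>1 (\<psi> k)))\<^sup>2
                             + (L2_norm \<Omega>2 (weak_deriv \<Omega>2 (\<phi> k)))\<^sup>2))) \<and>
    (convergent (\<lambda>r. H1_norm (\<Omega>1 \<times> \<Omega>2) (ur r)) \<longrightarrow>
      (\<lambda>r. H1_norm (\<Omega>1 \<times> \<Omega>2) (\<lambda>z. u z - ur r z)) \<longlonglongrightarrow> 0 \<and>
      (\<forall>r. (\<lambda>j. let k = r + 1 + j in
               (\<sigma> k)\<^sup>2 * (1 + (L2_norm \<Omega>1 (weak_deriv \<Omega>1 (\<psi> k)))\<^sup>2
                            + (L2_norm \<Omega>2 (weak_deriv \<Omega>2 (\<phi> k)))\<^sup>2))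
           sums (H1_norm (\<Omega>1 \<times> \<Omega>2) (\<lambda>z. u z - ur r z))\<^sup>2))"
proof -
  let ?\<Omega> = "\<Omega>1 \<times> \<Omega>2"
  note op1 = \<open>open \<Omega>1\<close> and op2 = \<open>open \<Omega>2\<close>
  have op: "open ?\<Omega>" using op1 op2 by (rule open_Times)
  obtain v w where v: "has_weak_partial ?\<Omega> (1, 0) u v" and w: "has_weak_partial ?\<Omega> (0, 1) u w"
    using \<open>u \<in> H1 ?\<Omega>\<close> by (auto simp: H1_def Basis_real_prod)
  interpret X: L2_SVD_weak_partial \<Omega>1 \<Omega>2 u \<sigma> \<psi> \<phi> v
    using op1 op2 assms(8) v by unfold_locales
  \<comment> \<open>The results on the derivative in \<open>x\<close>, applied after exchanging the variables, give those in \<open>y\<close>.\<close>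
  interpret Y: L2_SVD_weak_partial \<Omega>2 \<Omega>1 "u \<circ> prod.swap" \<sigma> \<phi> \<psi> "w \<circ> prod.swap"
    using X.swap has_weak_partial_swap[OF op1 op2 w]
    by (auto simp: L2_SVD_weak_partial_def L2_SVD_weak_partial_axioms_def Basis_real_prod)
  let ?S = "svd_partial_sum \<sigma> \<psi> \<phi>"
  let ?Sx = "svd_partial_sum \<sigma> X.d\<psi> \<phi>"
  let ?Sy = "\<lambda>r. svd_partial_sum \<sigma> Y.d\<psi> \<psi> r \<circ> prod.swap"
  have sw: "svd_partial_sum \<sigma> \<phi> \<psi> r \<circ> prod.swap = ?S r" for r
    by (auto simp: svd_partial_sum_def tensor_def mult_ac fun_eq_iff)
  have Sx: "has_weak_partial ?\<Omega> (1, 0) (?S r) (?Sx r)" for r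
    by (rule X.has_weak_partial_svd_partial_sum)
  have Sy: "has_weak_partial ?\<Omega> (0, 1) (?S r) (?Sy r)" for r
    using has_weak_partial_swap[OF op2 op1 Y.has_weak_partial_svd_partial_sum] sw
    by (simp add: Basis_real_prod)
  have dx: "has_weak_partial ?\<Omega> (1, 0) (\<lambda>z. u z - ?S r z) (\<lambda>z. v z - ?Sx r z)"
    and dy: "has_weak_partial ?\<Omega> (0, 1) (\<lambda>z. u z - ?S r z) (\<lambda>z. w z - ?Sy r z)" for r
    by (intro has_weak_partial_diff op v w Sx Sy; simp add: Basis_real_prod)+
  \<comment> \<open>The norm of \<open>\<psi> k\<close> is 1 if \<open>\<sigma> k > 0\<close>; otherwise it is arbitrary, but multiplied by 0.\<close>
  have one: "(\<sigma> k)\<^sup>2 * (L2_norm \<Omega>1 (\<psi> k))\<^sup>2 = (\<sigma> k)\<^sup>2" if "1 \<le> k" for k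
    using X.L2_norm_\<psi>[OF that] X.\<sigma>_eq_0[OF that] by (cases "0 < \<sigma> k") auto
  have summand_eq: "(\<sigma> k)\<^sup>2 * (L2_norm \<Omega>1 (\<psi> k))\<^sup>2 + (\<sigma> k)\<^sup>2 * a + (\<sigma> k)\<^sup>2 * b = (\<sigma> k)\<^sup>2 * (1 + a + b)"
    if "1 \<le> k" for k a b
    by (simp only: one[OF that] distrib_left mult_1_right)
  have Sy_L2: "svd_partial_sum \<sigma> Y.d\<psi> \<psi> r \<in> L2 (\<Omega>2 \<times> \<Omega>1)" for r
    using Y.has_weak_partial_svd_partial_sum by (auto simp: has_weak_partial_def)
  have w_L2: "w \<circ> prod.swap \<in> L2 (\<Omega>2 \<times> \<Omega>1)" by (rule Y.v_L2)
  have nSy: "L2_norm ?\<Omega> (?Sy r) = L2_norm (\<Omega>2 \<times> \<Omega>1) (svd_partial_sum \<sigma> Y.d\<psi> \<psi> r)"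
    and nwSy: "L2_norm ?\<Omega> (\<lambda>z. w z - ?Sy r z) =
      L2_norm (\<Omega>2 \<times> \<Omega>1) (\<lambda>z. (w \<circ> prod.swap) z - svd_partial_sum \<sigma> Y.d\<psi> \<psi> r z)" for r
    using L2_norm_swap[OF op2 op1 Sy_L2] L2_norm_swap[OF op2 op1 L2_diff[OF w_L2 Sy_L2]]
    by (simp_all add: o_def)
  have S_norm: "(L2_norm ?\<Omega> (?S r))\<^sup>2 = (\<Sum>k=1..r. (\<sigma> k)\<^sup>2 * (L2_norm \<Omega>1 (\<psi> k))\<^sup>2)" for r
    using X.\<psi>_L2 by (rule X.L2_norm_svd_partial_sum)
  have u_lim: "(\<lambda>r. L2_norm ?\<Omega> (\<lambda>z. u z - ?S r z)) \<longlonglongrightarrow> 0"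
    using assms(8) by (simp add: is_L2_SVD_def)
  show ?thesis
  proof (intro conjI allI impI)
    show "\<psi> k \<in> H1 \<Omega>1" if "1 \<le> k" "0 < \<sigma> k" for k
      using X.\<psi>_L2[OF that] X.has_weak_partial_\<psi>[OF that] by (auto simp: H1_def)
    show "\<phi> k \<in> H1 \<Omega>2" if "1 \<le> k" "0 < \<sigma> k" for k
      using X.\<phi>_L2[OF that] Y.has_weak_partial_\<psi>[OF that] by (auto simp: H1_def)
    show "ur r \<in> H1 ?\<Omega>" for r
      using Sx[of r] Sy[of r] assms(9)[of r] by (auto simp: H1_def Basis_real_prod has_weak_partial_def)
    show "(H1_norm ?\<Omega> (ur r))\<^sup>2 = (\<Sum>k=1..r. (\<sigma> k)\<^sup>2 * (1 + (L2_norm \<Omega>1 (X.d\<psi> k))\<^sup>2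
        + (L2_norm \<Omega>2 (Y.d\<psi> k))\<^sup>2))" for r
      unfolding assms(9) H1_norm_power2[OF op1 op2 Sx Sy] nSy S_norm
        X.L2_norm_partial_svd_partial_sum Y.L2_norm_partial_svd_partial_sum
        sum.distrib [symmetric]
      by (intro sum.cong refl summand_eq) simp
    have "(\<lambda>r. (H1_norm ?\<Omega> (\<lambda>z. u z - ur r z))\<^sup>2) \<longlonglongrightarrow> 0\<^sup>2 + 0\<^sup>2 + 0\<^sup>2"
      unfolding assms(9) H1_norm_power2[OF op1 op2 dx dy] nwSy
      by (intro tendsto_add tendsto_power u_lim X.svd_partial_sum_tendsto_v Y.svd_partial_sum_tendsto_v)
    then have "(\<lambda>r. sqrt ((H1_norm ?\<Omega> (\<lambda>z. u z - ur r z))\<^sup>2)) \<longlonglongrightarrow> sqrt 0"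
      by (intro tendsto_real_sqrt) simp
    then show "(\<lambda>r. H1_norm ?\<Omega> (\<lambda>z. u z - ur r z)) \<longlonglongrightarrow> 0"
      by (simp add: H1_norm_def add_nonneg_nonneg sum_nonneg)
    fix r
    have "(\<lambda>j. (\<sigma> (r + 1 + j))\<^sup>2 * (L2_norm \<Omega>1 (\<psi> (r + 1 + j)))\<^sup>2
          + (\<sigma> (r + 1 + j))\<^sup>2 * (L2_norm \<Omega>1 (X.d\<psi> (r + 1 + j)))\<^sup>2
          + (\<sigma> (r + 1 + j))\<^sup>2 * (L2_norm \<Omega>2 (Y.d\<psi> (r + 1 + j)))\<^sup>2)
        sums (H1_norm ?\<Omega> (\<lambda>z. u z - ur r z))\<^sup>2"
      unfolding assms(9) H1_norm_power2[OF op1 op2 dx dy] nwSy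
      by (intro sums_add X.svd_tail_sums[of \<psi>, OF X.\<psi>_L2 X.u_L2 u_lim]
          X.partial_svd_tail_sums Y.partial_svd_tail_sums)
    moreover have "1 \<le> r + 1 + j" for j by simp
    ultimately show "(\<lambda>j. let k = r + 1 + j in (\<sigma> k)\<^sup>2 * (1 + (L2_norm \<Omega>1 (X.d\<psi> k))\<^sup>2
        + (L2_norm \<Omega>2 (Y.d\<psi> k))\<^sup>2)) sums (H1_norm ?\<Omega> (\<lambda>z. u z - ur r z))\<^sup>2"
      by (simp only: Let_def summand_eq)
  qed
qed

end
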